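(* Let $\gamma:I\to\mathbb{G}$ be a unit speed Frenet curve with $\tau-\tau_{\mathbb G}\neq0$ on $I$, and let $\gamma^*$ be its conjugate mate. Then $\gamma$ is a slant helix if and only if $\gamma^*$ is a slant helix.
   Context: Let $\mathbb{G}$ be a three-dimensional Lie group with a bi-invariant Riemannian metric $\langle\cdot,\cdot\rangle$, with (oriented) Lie algebra $\mathfrak g$ and Levi-Civita connection $\nabla$; $I\subset\mathbb R$ is an interval and curves are smooth. Vector fields along a curve in $\mathbb G$ are identified with $\mathfrak g$-valued maps by left translation: fixing an orthonormal basis $X_1,X_2,X_3$ of left-invariant fields, write $U=\sum u_iX_i$, and set $U'=\sum u_i'X_i$, $[U,V]=\sum u_iv_j[X_i,X_j]$; then $\nabla_TU=U'+\frac12[T,U]$ with $T=\gamma'$. Vector fields along different curves with the same parameter interval are compared as $\mathfrak g$-valued maps. A unit speed curve $\gamma$ has Frenet-Serret apparatus $\{T,N,B,\kappa,\tau\}$ if $\kappa=\|\nabla_TT\|>0$, $(T,N,B)$ is a positively oriented orthonormal frame, and $\nabla_TT=\kappa N$, $\nabla_TN=-\kappa T+\tau B$, $\nabla_TB=-\tau N$. It is a Frenet curve if moreover $\tau\neq0$. The Lie group torsion is $\tau_{\mathbb G}=\frac12\langle[T,N],B\rangle$; the harmonic curvature is $H=(\tau-\tau_{\mathbb G})/\kappa$. The same notions apply to any unit speed curve with a Frenet-Serret apparatus. A unit speed curve $\gamma^*:I\to\mathbb G$ with Frenet-Serret apparatus $\{T^*,N^*,B^*,\kappa^*,\tau^*\}$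 is the conjugate mate of $\gamma$ if $T^*=B$. A curve is a slant helix iff $\dfrac1\sigma=\dfrac{H'}{\kappa(H^2+1)^{3/2}}$ is a constant function (characterization taken as the definition). *)

theory Defs
  imports "HOL-Analysis.Analysis" "HOL-Algebra.Group"
begin

section \<open>Smoothness in Euclidean spaces\<close>

text \<open>
  Derivatives are taken within \<open>S\<close>, so that curves on intervals containing an endpoint are
  covered.  The notion is only used for sets in which the derivative is unique: open sets,
  and relatively open subsets of a nondegenerate real interval.
\<close>

fun Ck_on :: "nat \<Rightarrow> 'a::euclidean_space set \<Rightarrow> ('a \<Rightarrow> 'b::euclidean_space) \<Rightarrow> bool" where
  "Ck_on 0 S f \<longleftrightarrow> continuous_on S f"
| "Ck_on (Suc k) S f \<longleftrightarrow>
     f differentiable_on S \<and> (\<forall>v. Ck_on k S (\<lambda>x. frechet_derivative f (at x within S) v))"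

definition smooth_on :: "'a::euclidean_space set \<Rightarrow> ('a \<Rightarrow> 'b::euclidean_space) \<Rightarrow> bool" where
  "smooth_on S f \<longleftrightarrow> (\<forall>k. Ck_on k S f)"


section \<open>Three-dimensional smooth manifolds\<close>

type_synonym 'g chart = "'g set \<times> ('g \<Rightarrow> real^3)"

definition smooth_atlas :: "'g::topological_space chart set \<Rightarrow> bool" where
  "smooth_atlas A \<longleftrightarrow>
     (\<Union>(U, \<phi>)\<in>A. U) = UNIV \<and>
     (\<forall>(U, \<phi>)\<in>A. open U \<and> open (\<phi> ` U) \<and> homeomorphism U (\<phi> ` U) \<phi> (inv_into U \<phi>)) \<and>
     (\<forall>(U, \<phi>)\<in>A. \<forall>(V, \<psi>)\<in>A. smooth_on (\<phi> ` (U \<inter> V)) (\<psi> \<circ> inv_into U \<phi>))"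

definition smooth_near :: "'g::topological_space chart set \<Rightarrow> 'g \<Rightarrow> ('g \<Rightarrow> real) \<Rightarrow> bool" where
  "smooth_near A p f \<longleftrightarrow>
     (\<exists>W. open W \<and> p \<in> W \<and> (\<forall>(U, \<phi>)\<in>A. smooth_on (\<phi> ` (U \<inter> W)) (f \<circ> inv_into U \<phi>)))"

definition smooth_curve_on ::
    "'g::topological_space chart set \<Rightarrow> real set \<Rightarrow> (real \<Rightarrow> 'g) \<Rightarrow> bool" where
  "smooth_curve_on A I c \<longleftrightarrow>
     continuous_on I c \<and> (\<forall>(U, \<phi>)\<in>A. smooth_on {t \<in> I. c t \<in> U} (\<phi> \<circ> c))"

text \<open>
  A tangent vector at \<open>p\<close> is the velocity of a smooth curve through \<open>p\<close>, regarded as the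
  directional derivative acting on the functions that are smooth near \<open>p\<close>, and set to \<open>0\<close> on
  all other functions (so that equality of tangent vectors is equality of functionals).
\<close>

type_synonym 'g tvec = "('g \<Rightarrow> real) \<Rightarrow> real"
type_synonym 'g vfield = "'g \<Rightarrow> 'g tvec"

definition velocity ::
    "'g::topological_space chart set \<Rightarrow> real set \<Rightarrow> (real \<Rightarrow> 'g) \<Rightarrow> real \<Rightarrow> 'g tvec" where
  "velocity A I c t =
     (\<lambda>f. if smooth_near A (c t) f then vector_derivative (f \<circ> c) (at t within I) else 0)"

definition tangent_space :: "'g::topological_space chart set \<Rightarrow> 'g \<Rightarrow> 'g tvec set" where
  "tangent_space A p =
     {velocity A {-e<..<e} c 0 | c e. e > 0 \<and> smooth_curve_on A {-e<..<e} c \<and> c 0 = p}"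

definition vector_fields :: "'g::topological_space chart set \<Rightarrow> 'g vfield set" where
  "vector_fields A =
     {X. (\<forall>p. X p \<in> tangent_space A p) \<and>
         (\<forall>p f. smooth_near A p f \<longrightarrow> smooth_near A p (\<lambda>q. X q f))}"

definition vf_bracket ::
    "'g::topological_space chart set \<Rightarrow> 'g vfield \<Rightarrow> 'g vfield \<Rightarrow> 'g vfield" where
  "vf_bracket A X Y p =
     (\<lambda>f. if smooth_near A p f then X p (\<lambda>q. Y q f) - Y p (\<lambda>q. X q f) else 0)"

text \<open>
  The differential of \<open>F\<close>, used for diffeomorphisms only: there \<open>f \<circ> F\<close> is smooth near \<open>p\<close> iff
  \<open>f\<close> is smooth near \<open>F p\<close>, so the convention on non-smooth functions is respected.
\<close>

definition pushforward :: "('g \<Rightarrow> 'g) \<Rightarrow> 'g tvec \<Rightarrow> 'g tvec" where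
  "pushforward F u = (\<lambda>f. u (f \<circ> F))"


section \<open>Riemannian metrics and the Levi-Civita connection\<close>

type_synonym 'g metric = "'g \<Rightarrow> 'g tvec \<Rightarrow> 'g tvec \<Rightarrow> real"

definition riemannian_metric :: "'g::topological_space chart set \<Rightarrow> 'g metric \<Rightarrow> bool" where
  "riemannian_metric A g \<longleftrightarrow>
     (\<forall>p. \<forall>u\<in>tangent_space A p. \<forall>v\<in>tangent_space A p. g p u v = g p v u) \<and>
     (\<forall>p. \<forall>u\<in>tangent_space A p. \<forall>v\<in>tangent_space A p. \<forall>w\<in>tangent_space A p. \<forall>a b.
        g p (\<lambda>f. a * u f + b * v f) w = a * g p u w + b * g p v w) \<and>
     (\<forall>p. \<forall>u\<in>tangent_space A p. u \<noteq> (\<lambda>_. 0) \<longrightarrow> g p u u > 0) \<and>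
     (\<forall>X\<in>vector_fields A. \<forall>Y\<in>vector_fields A. \<forall>p. smooth_near A p (\<lambda>q. g q (X q) (Y q)))"

definition affine_connection ::
    "'g::topological_space chart set \<Rightarrow> ('g vfield \<Rightarrow> 'g vfield \<Rightarrow> 'g vfield) \<Rightarrow> bool" where
  "affine_connection A nab \<longleftrightarrow>
     (\<forall>X\<in>vector_fields A. \<forall>Y\<in>vector_fields A. nab X Y \<in> vector_fields A) \<and>
     (\<forall>X\<in>vector_fields A. \<forall>Y\<in>vector_fields A. \<forall>Z\<in>vector_fields A. \<forall>a b.
        (\<forall>p. smooth_near A p a) \<and> (\<forall>p. smooth_near A p b) \<longrightarrow>
        nab (\<lambda>p f. a p * X p f + b p * Y p f) Z =
          (\<lambda>p f. a p * nab X Z p f + b p * nab Y Z p f)) \<and>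
     (\<forall>X\<in>vector_fields A. \<forall>Y\<in>vector_fields A. \<forall>Z\<in>vector_fields A.
        nab X (\<lambda>p f. Y p f + Z p f) = (\<lambda>p f. nab X Y p f + nab X Z p f)) \<and>
     (\<forall>X\<in>vector_fields A. \<forall>Y\<in>vector_fields A. \<forall>a. (\<forall>p. smooth_near A p a) \<longrightarrow>
        nab X (\<lambda>p f. a p * Y p f) = (\<lambda>p f. X p a * Y p f + a p * nab X Y p f))"

definition levi_civita ::
    "'g::topological_space chart set \<Rightarrow> 'g metric \<Rightarrow>
     ('g vfield \<Rightarrow> 'g vfield \<Rightarrow> 'g vfield) \<Rightarrow> bool" where
  "levi_civita A g nab \<longleftrightarrow>
     affine_connection A nab \<and>
     (\<forall>X\<in>vector_fields A. \<forall>Y\<in>vector_fields A.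
        (\<lambda>p f. nab X Y p f - nab Y X p f) = vf_bracket A X Y) \<and>
     (\<forall>X\<in>vector_fields A. \<forall>Y\<in>vector_fields A. \<forall>Z\<in>vector_fields A. \<forall>p.
        X p (\<lambda>q. g q (Y q) (Z q)) = g p (nab X Y p) (Z p) + g p (Y p) (nab X Z p))"


section \<open>Lie groups with a bi-invariant metric\<close>

definition lie_group ::
    "'g::{t2_space,second_countable_topology} monoid \<Rightarrow> 'g chart set \<Rightarrow> bool" where
  "lie_group G A \<longleftrightarrow>
     group G \<and> carrier G = UNIV \<and> smooth_atlas A \<and>
     continuous_on UNIV (\<lambda>(x, y). x \<otimes>\<^bsub>G\<^esub> y) \<and>
     continuous_on UNIV (\<lambda>x. inv\<^bsub>G\<^esub> x) \<and>
     (\<forall>(U, \<phi>)\<in>A. \<forall>(V, \<psi>)\<in>A. \<forall>(W, \<theta>)\<in>A.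
        smooth_on {(x, y). x \<in> \<phi> ` U \<and> y \<in> \<psi> ` V \<and> inv_into U \<phi> x \<otimes>\<^bsub>G\<^esub> inv_into V \<psi> y \<in> W}
          (\<lambda>(x, y). \<theta> (inv_into U \<phi> x \<otimes>\<^bsub>G\<^esub> inv_into V \<psi> y))) \<and>
     (\<forall>(U, \<phi>)\<in>A. \<forall>(W, \<theta>)\<in>A.
        smooth_on {x. x \<in> \<phi> ` U \<and> inv\<^bsub>G\<^esub> (inv_into U \<phi> x) \<in> W}
          (\<lambda>x. \<theta> (inv\<^bsub>G\<^esub> (inv_into U \<phi> x))))"

definition left_invariant_fields ::
    "'g::topological_space monoid \<Rightarrow> 'g chart set \<Rightarrow> 'g vfield set" where
  "left_invariant_fields G A =
     {X \<in> vector_fields A. \<forall>h p. X (h \<otimes>\<^bsub>G\<^esub> p) = pushforward (\<lambda>x. h \<otimes>\<^bsub>G\<^esub> x) (X p)}"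

definition bi_invariant ::
    "'g::topological_space monoid \<Rightarrow> 'g chart set \<Rightarrow> 'g metric \<Rightarrow> bool" where
  "bi_invariant G A g \<longleftrightarrow>
     (\<forall>h p. \<forall>u\<in>tangent_space A p. \<forall>v\<in>tangent_space A p.
        g (h \<otimes>\<^bsub>G\<^esub> p) (pushforward (\<lambda>x. h \<otimes>\<^bsub>G\<^esub> x) u) (pushforward (\<lambda>x. h \<otimes>\<^bsub>G\<^esub> x) v) = g p u v \<and>
        g (p \<otimes>\<^bsub>G\<^esub> h) (pushforward (\<lambda>x. x \<otimes>\<^bsub>G\<^esub> h) u) (pushforward (\<lambda>x. x \<otimes>\<^bsub>G\<^esub> h) v) = g p u v)"

definition orthonormal_basis ::
    "'g::topological_space monoid \<Rightarrow> 'g chart set \<Rightarrow> 'g metric \<Rightarrow> (3 \<Rightarrow> 'g vfield) \<Rightarrow> bool" where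
  "orthonormal_basis G A g X \<longleftrightarrow>
     (\<forall>i. X i \<in> left_invariant_fields G A) \<and>
     (\<forall>Y\<in>left_invariant_fields G A. \<exists>a :: 3 \<Rightarrow> real. Y = (\<lambda>p f. \<Sum>i\<in>UNIV. a i * X i p f)) \<and>
     (\<forall>p i j. g p (X i p) (X j p) = (if i = j then 1 else 0))"


section \<open>Vector fields along curves as Lie algebra valued maps\<close>

text \<open>
  Relative to an orthonormal basis \<open>X\<close> of the Lie algebra, an element is given by its coordinate
  vector in \<^typ>\<open>real^3\<close>; the metric becomes the standard inner product.  The basis \<open>X\<close> is
  positively oriented by definition, which amounts to the choice of an orientation.  In
  \<open>frame_bracket\<close> the structure constants of the left-invariant fields are read off at the
  identity.
\<close>

definition frame_bracket ::
    "'g::topological_space monoid \<Rightarrow> 'g chart set \<Rightarrow> 'g metric \<Rightarrow> (3 \<Rightarrow> 'g vfield) \<Rightarrow>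
     real^3 \<Rightarrow> real^3 \<Rightarrow> real^3" where
  "frame_bracket G A g X u v =
     (\<chi> k. \<Sum>i\<in>UNIV. \<Sum>j\<in>UNIV. u $ i * v $ j *
        g \<one>\<^bsub>G\<^esub> (vf_bracket A (X i) (X j) \<one>\<^bsub>G\<^esub>) (X k \<one>\<^bsub>G\<^esub>))"

text \<open>
  For \<open>U = (\<Sum>j. U\<^sub>j X\<^sub>j)\<close> along \<open>c\<close> with \<open>c' = (\<Sum>i. T\<^sub>i X\<^sub>i)\<close>, the Leibniz rule gives
  \<open>\<nabla>\<^sub>T U = (\<Sum>j. U\<^sub>j' X\<^sub>j) + (\<Sum>i j. T\<^sub>i U\<^sub>j \<nabla>\<^sub>X\<^sub>i X\<^sub>j)\<close>, written here in the basis \<open>X\<close>.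
\<close>

definition cov_deriv ::
    "'g metric \<Rightarrow> ('g vfield \<Rightarrow> 'g vfield \<Rightarrow> 'g vfield) \<Rightarrow> (3 \<Rightarrow> 'g vfield) \<Rightarrow> real set \<Rightarrow>
     (real \<Rightarrow> 'g) \<Rightarrow> (real \<Rightarrow> real^3) \<Rightarrow> (real \<Rightarrow> real^3) \<Rightarrow> real \<Rightarrow> real^3" where
  "cov_deriv g nab X I c T U t =
     vector_derivative U (at t within I) +
     (\<chi> k. \<Sum>i\<in>UNIV. \<Sum>j\<in>UNIV. T t $ i * U t $ j * g (c t) (nab (X i) (X j) (c t)) (X k (c t)))"


section \<open>Frenet-Serret apparatus and slant helices\<close>

definition unit_speed ::
    "'g::topological_space chart set \<Rightarrow> 'g metric \<Rightarrow> real set \<Rightarrow> (real \<Rightarrow> 'g) \<Rightarrow> bool" where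
  "unit_speed A g I c \<longleftrightarrow>
     smooth_curve_on A I c \<and> (\<forall>t\<in>I. g (c t) (velocity A I c t) (velocity A I c t) = 1)"

definition frenet_apparatus ::
    "'g::topological_space chart set \<Rightarrow> 'g metric \<Rightarrow> ('g vfield \<Rightarrow> 'g vfield \<Rightarrow> 'g vfield) \<Rightarrow>
     (3 \<Rightarrow> 'g vfield) \<Rightarrow> real set \<Rightarrow> (real \<Rightarrow> 'g) \<Rightarrow>
     (real \<Rightarrow> real^3) \<Rightarrow> (real \<Rightarrow> real^3) \<Rightarrow> (real \<Rightarrow> real^3) \<Rightarrow>
     (real \<Rightarrow> real) \<Rightarrow> (real \<Rightarrow> real) \<Rightarrow> bool" where
  "frenet_apparatus A g nab X I c T N B \<kappa> \<tau> \<longleftrightarrow>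
     unit_speed A g I c \<and>
     smooth_on I T \<and> smooth_on I N \<and> smooth_on I B \<and>
     (\<forall>t\<in>I.
        velocity A I c t = (\<lambda>f. \<Sum>i\<in>UNIV. T t $ i * X i (c t) f) \<and>
        \<kappa> t = norm (cov_deriv g nab X I c T T t) \<and> \<kappa> t > 0 \<and>
        norm (T t) = 1 \<and> norm (N t) = 1 \<and> norm (B t) = 1 \<and>
        T t \<bullet> N t = 0 \<and> T t \<bullet> B t = 0 \<and> N t \<bullet> B t = 0 \<and>
        det (vector [T t, N t, B t] :: real^3^3) > 0 \<and>
        cov_deriv g nab X I c T T t = \<kappa> t *\<^sub>R N t \<and>
        cov_deriv g nab X I c T N t = - \<kappa> t *\<^sub>R T t + \<tau> t *\<^sub>R B t \<and>
        cov_deriv g nab X I c T B t = - \<tau> t *\<^sub>R N t)"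

definition lie_torsion ::
    "'g::topological_space monoid \<Rightarrow> 'g chart set \<Rightarrow> 'g metric \<Rightarrow> (3 \<Rightarrow> 'g vfield) \<Rightarrow>
     (real \<Rightarrow> real^3) \<Rightarrow> (real \<Rightarrow> real^3) \<Rightarrow> (real \<Rightarrow> real^3) \<Rightarrow> real \<Rightarrow> real" where
  "lie_torsion G A g X T N B t = (1/2) * (frame_bracket G A g X (T t) (N t) \<bullet> B t)"

definition harmonic_curvature ::
    "'g::topological_space monoid \<Rightarrow> 'g chart set \<Rightarrow> 'g metric \<Rightarrow> (3 \<Rightarrow> 'g vfield) \<Rightarrow>
     (real \<Rightarrow> real^3) \<Rightarrow> (real \<Rightarrow> real^3) \<Rightarrow> (real \<Rightarrow> real^3) \<Rightarrow>
     (real \<Rightarrow> real) \<Rightarrow> (real \<Rightarrow> real) \<Rightarrow> real \<Rightarrow> real" where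
  "harmonic_curvature G A g X T N B \<kappa> \<tau> t = (\<tau> t - lie_torsion G A g X T N B t) / \<kappa> t"

definition slant_helix ::
    "'g::topological_space monoid \<Rightarrow> 'g chart set \<Rightarrow> 'g metric \<Rightarrow>
     ('g vfield \<Rightarrow> 'g vfield \<Rightarrow> 'g vfield) \<Rightarrow> (3 \<Rightarrow> 'g vfield) \<Rightarrow> real set \<Rightarrow> (real \<Rightarrow> 'g) \<Rightarrow> bool" where
  "slant_helix G A g nab X I c \<longleftrightarrow>
     (\<exists>T N B \<kappa> \<tau>. frenet_apparatus A g nab X I c T N B \<kappa> \<tau> \<and>
        (let H = harmonic_curvature G A g X T N B \<kappa> \<tau> in
         \<exists>C. \<forall>t\<in>I. vector_derivative H (at t within I) /
                     (\<kappa> t * ((H t)\<^sup>2 + 1) powr (3/2)) = C))"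

definition conjugate_mate ::
    "'g::topological_space chart set \<Rightarrow> 'g metric \<Rightarrow> ('g vfield \<Rightarrow> 'g vfield \<Rightarrow> 'g vfield) \<Rightarrow>
     (3 \<Rightarrow> 'g vfield) \<Rightarrow> real set \<Rightarrow> (real \<Rightarrow> 'g) \<Rightarrow> (real \<Rightarrow> 'g) \<Rightarrow> bool" where
  "conjugate_mate A g nab X I c d \<longleftrightarrow>
     (\<exists>T N B \<kappa> \<tau> T' N' B' \<kappa>' \<tau>'.
        frenet_apparatus A g nab X I c T N B \<kappa> \<tau> \<and>
        frenet_apparatus A g nab X I d T' N' B' \<kappa>' \<tau>' \<and>
        (\<forall>t\<in>I. T' t = B t))"

end

theory Submission
  imports Defs
begin

text \<open>
  The geometry enters only through one constant.  In a left-invariant orthonormal frame, a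
  bi-invariant metric makes the structure constants \<open>\<langle>[X\<^sub>i, X\<^sub>j], X\<^sub>k\<rangle>\<close> totally skew.  In dimension
  three this forces \<open>[u, v] = 2 b (u \<times> v)\<close> for a real number \<open>b\<close>, and Koszul's formula turns it into
  \<open>\<nabla>\<^sub>T U = U' + b (T \<times> U)\<close> (\<open>bracket_and_connection_cross\<close>).  Hence the Lie group torsion of every
  curve equals \<open>b\<close>, and in the Frenet equations the terms \<open>b (T \<times> _)\<close> just shift the torsion:
  with \<open>\<rho> = \<tau> - b\<close>, the coordinate frame satisfies \<open>T' = \<kappa> N\<close>, \<open>N' = - \<kappa> T + \<rho> B\<close>, \<open>B' = - \<rho> N\<close>.
  So the frames are ordinary Frenet frames in Euclidean three-space with curvature \<open>\<kappa>\<close> and torsion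
  \<open>\<rho>\<close>, and the harmonic curvature is \<open>H = \<rho> / \<kappa>\<close> (\<open>apparatus_frenet_frame\<close>).

  If a second such frame has tangent \<open>B\<close>, let \<open>s\<close> be the sign of \<open>\<rho>\<close>, which is constant because \<open>\<rho>\<close> is
  continuous and nonzero on an interval.  Then \<open>(B, - s N, s T)\<close> is a Frenet frame with curvature
  \<open>s \<rho>\<close> and torsion \<open>\<kappa>\<close>, and by uniqueness it is the frame of the mate (\<open>frenet_frame_mate\<close>).
  The harmonic curvature of the mate is therefore \<open>s / H\<close>, and the quotient that defines slant
  helices gets multiplied by \<open>- s\<close> (\<open>slant_quotient_mate\<close>), so it is constant for one curve exactly
  if it is constant for the other.

  The larger part of the work is the total skewness.  A right translation by \<open>h\<close> carries \<open>X\<^sub>j\<close> to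
  \<open>\<Sum>k. a\<^sub>k\<^sub>j(h) X\<^sub>k\<close>, and bi-invariance says that the matrix \<open>a(h)\<close> is orthogonal.  Let \<open>h\<close> move along a
  curve that leaves the identity in the direction \<open>X\<^sub>i\<close>.  For a function \<open>f\<close>, the derivative of
  \<open>X\<^sub>j (f (\<cdot> h))\<close> is a mixed second derivative of \<open>(x, y) \<mapsto> f (x y)\<close>, and by the symmetry of
  second derivatives it equals \<open>X\<^sub>j (X\<^sub>i f)\<close> (\<open>translation_derivatives\<close>).  Differentiating
  the expansion of the translated field, one gets \<open>[X\<^sub>j, X\<^sub>i] = \<Sum>k. a'\<^sub>k\<^sub>j X\<^sub>k\<close>, where
  \<open>a'\<close> is skew as the derivative of a curve of orthogonal matrices at the identity matrix
  (\<open>frame_bracket_fixed\<close>).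
\<close>

section \<open>Smooth functions between Euclidean spaces\<close>

text \<open>
  The derivative is picked by a choice operator among all derivatives within \<open>S\<close>, and those
  of \<open>f\<close> and \<open>g\<close> are the same.
\<close>

lemma frechet_derivative_cong_on:
  assumes "x \<in> S" "\<And>y. y \<in> S \<Longrightarrow> f y = g y"
  shows "frechet_derivative f (at x within S) = frechet_derivative g (at x within S)"
proof -
  have "(f has_derivative f') (at x within S) \<longleftrightarrow> (g has_derivative f') (at x within S)" for f'
    using assms has_derivative_transform[of x S f g f'] has_derivative_transform[of x S g f f'] by auto
  then show ?thesis
    unfolding frechet_derivative_def by presburger
qed

lemma Ck_on_cong:
  assumes "\<And>x. x \<in> S \<Longrightarrow> f x = g x"
  shows "Ck_on k S f \<longleftrightarrow> Ck_on k S g"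
  using assms
proof (induction k arbitrary: f g)
  case 0
  then show ?case by (simp cong: continuous_on_cong)
next
  case (Suc k)
  have 1: "f differentiable_on S \<longleftrightarrow> g differentiable_on S"
  proof -
    have "\<phi> differentiable_on S" if "\<psi> differentiable_on S" "\<And>x. x \<in> S \<Longrightarrow> \<phi> x = \<psi> x" for \<phi> \<psi> :: "'a \<Rightarrow> 'b"
      using that differentiable_transform_within[OF _ zero_less_one] unfolding differentiable_on_def by metis
    from this[of f g] this[of g f] Suc.prems show ?thesis by auto
  qed
  have "Ck_on k S (\<lambda>x. frechet_derivative f (at x within S) v) \<longleftrightarrow>
        Ck_on k S (\<lambda>x. frechet_derivative g (at x within S) v)" for v
    by (rule Suc.IH) (simp add: frechet_derivative_cong_on[OF _ Suc.prems])
  with 1 show ?case by simp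
qed

lemma Ck_on_Suc_open:
  assumes "open S"
  shows "Ck_on (Suc k) S f \<longleftrightarrow>
    (\<forall>x\<in>S. f differentiable (at x)) \<and> (\<forall>v. Ck_on k S (\<lambda>x. frechet_derivative f (at x) v))"
proof -
  have "Ck_on k S (\<lambda>x. frechet_derivative f (at x within S) v) \<longleftrightarrow>
        Ck_on k S (\<lambda>x. frechet_derivative f (at x) v)" for v
    by (rule Ck_on_cong) (simp add: at_within_open[OF _ assms])
  then show ?thesis
    by (simp add: differentiable_on_def at_within_open[OF _ assms])
qed

lemma Ck_on_subset:
  assumes "open S" "open S'" "S' \<subseteq> S" "Ck_on k S f"
  shows "Ck_on k S' f"
  using assms(4)
proof (induction k arbitrary: f)
  case 0
  then show ?case using assms(3) continuous_on_subset by auto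
next
  case (Suc k)
  then show ?case
    using assms(1-3) by (auto simp: Ck_on_Suc_open simp del: Ck_on.simps)
qed

lemma Ck_on_Suc_imp: "Ck_on (Suc k) S f \<Longrightarrow> Ck_on k S f"
proof (induction k arbitrary: f)
  case 0
  then show ?case by (simp add: differentiable_imp_continuous_on)
next
  case (Suc k)
  then show ?case by (meson Ck_on.simps(2))
qed

lemma Ck_on_const: "Ck_on k S (\<lambda>x. c)" if "open S"
  using that
  by (induction k arbitrary: c) (auto simp: Ck_on_Suc_open simp del: Ck_on.simps(2))

lemma Ck_on_linear:
  assumes "bounded_linear L" "open S"
  shows "Ck_on k S L"
proof (cases k)
  case 0
  then show ?thesis using assms by (simp add: linear_continuous_on)
next
  case (Suc j)
  have "frechet_derivative L (at x) v = L v" for x v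
    using frechet_derivative_at[OF bounded_linear_imp_has_derivative[OF assms(1)]] by metis
  then show ?thesis
    using Suc assms by (simp add: Ck_on_Suc_open Ck_on_const bounded_linear_imp_differentiable del: Ck_on.simps)
qed

lemma frechet_derivative_eqI: "(f has_derivative f') (at x) \<Longrightarrow> frechet_derivative f (at x) = f'"
  using frechet_derivative_at by metis

lemma Ck_on_add:
  assumes "open S" "Ck_on k S f" "Ck_on k S g"
  shows "Ck_on k S (\<lambda>x. f x + g x)"
  using assms(2,3)
proof (induction k arbitrary: f g)
  case 0
  then show ?case by (simp add: continuous_on_add)
next
  case (Suc k)
  have d: "f differentiable (at x)" "g differentiable (at x)" if "x \<in> S" for x
    using Suc.prems that by (auto simp: Ck_on_Suc_open assms(1) simp del: Ck_on.simps)
  have e: "frechet_derivative (\<lambda>x. f x + g x) (at x) v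
      = frechet_derivative f (at x) v + frechet_derivative g (at x) v" if "x \<in> S" for x v
    using frechet_derivative_eqI[OF has_derivative_add[OF d[OF that, unfolded frechet_derivative_works]]]
    by metis
  have "Ck_on k S (\<lambda>x. frechet_derivative f (at x) v + frechet_derivative g (at x) v)" for v
    using Suc by (auto simp: Ck_on_Suc_open assms(1) simp del: Ck_on.simps)
  then have "Ck_on k S (\<lambda>x. frechet_derivative (\<lambda>x. f x + g x) (at x) v)" for v
    using Ck_on_cong[of S "\<lambda>x. frechet_derivative (\<lambda>x. f x + g x) (at x) v"] e by auto
  then show ?case
    using d by (simp add: Ck_on_Suc_open assms(1) del: Ck_on.simps)
qed

lemma Ck_on_sum:
  assumes "open S" "\<And>i. i \<in> F \<Longrightarrow> Ck_on k S (f i)"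
  shows "Ck_on k S (\<lambda>x. \<Sum>i\<in>F. f i x)"
  using assms(2)
  by (induction F rule: infinite_finite_induct) (auto simp: Ck_on_const Ck_on_add assms(1))

lemma Ck_on_scaleR:
  fixes f :: "'a::euclidean_space \<Rightarrow> real" and g :: "'a \<Rightarrow> 'b::euclidean_space"
  assumes "open S" "Ck_on k S f" "Ck_on k S g"
  shows "Ck_on k S (\<lambda>x. f x *\<^sub>R g x)"
  using assms(2,3)
proof (induction k arbitrary: f g)
  case 0
  then show ?case by (simp add: continuous_on_scaleR)
next
  case (Suc k)
  have d: "f differentiable (at x)" "g differentiable (at x)" if "x \<in> S" for x
    using Suc.prems that by (auto simp: Ck_on_Suc_open assms(1) simp del: Ck_on.simps)
  have e: "frechet_derivative (\<lambda>x. f x *\<^sub>R g x) (at x) v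
      = f x *\<^sub>R frechet_derivative g (at x) v + frechet_derivative f (at x) v *\<^sub>R g x" if "x \<in> S" for x v
    using frechet_derivative_eqI[OF has_derivative_scaleR[OF d[OF that, unfolded frechet_derivative_works]]]
    by metis
  have "Ck_on k S (\<lambda>x. f x *\<^sub>R frechet_derivative g (at x) v + frechet_derivative f (at x) v *\<^sub>R g x)" for v
    using Suc.prems Suc.IH Ck_on_Suc_imp[OF Suc.prems(1)] Ck_on_Suc_imp[OF Suc.prems(2)]
    by (intro Ck_on_add Suc.IH assms(1)) (auto simp: Ck_on_Suc_open assms(1) simp del: Ck_on.simps)
  then have "Ck_on k S (\<lambda>x. frechet_derivative (\<lambda>x. f x *\<^sub>R g x) (at x) v)" for v
    using Ck_on_cong[of S "\<lambda>x. frechet_derivative (\<lambda>x. f x *\<^sub>R g x) (at x) v"] e by auto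
  then show ?case
    using d by (simp add: Ck_on_Suc_open assms(1) differentiable_scaleR del: Ck_on.simps)
qed

lemma Ck_on_inner:
  assumes "open S" "Ck_on k S f"
  shows "Ck_on k S (\<lambda>x. f x \<bullet> c)"
  using assms(2)
proof (induction k arbitrary: f)
  case 0
  then show ?case by (simp add: continuous_on_inner)
next
  case (Suc k)
  have d: "f differentiable (at x)" if "x \<in> S" for x
    using Suc.prems that by (auto simp: Ck_on_Suc_open assms(1) simp del: Ck_on.simps)
  have e: "frechet_derivative (\<lambda>x. f x \<bullet> c) (at x) v = frechet_derivative f (at x) v \<bullet> c" if "x \<in> S" for x v
    using frechet_derivative_eqI[OF has_derivative_inner_left[OF d[OF that, unfolded frechet_derivative_works]]]
    by metis
  have "Ck_on k S (\<lambda>x. frechet_derivative f (at x) v \<bullet> c)" for v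
    using Suc by (auto simp: Ck_on_Suc_open assms(1) simp del: Ck_on.simps)
  then have "Ck_on k S (\<lambda>x. frechet_derivative (\<lambda>x. f x \<bullet> c) (at x) v)" for v
    using Ck_on_cong[of S "\<lambda>x. frechet_derivative (\<lambda>x. f x \<bullet> c) (at x) v"] e by auto
  then show ?case
    using d by (auto simp: Ck_on_Suc_open assms(1) simp del: Ck_on.simps)
qed

lemma linear_euclidean_sum:
  fixes L :: "'a::euclidean_space \<Rightarrow> 'b::real_vector"
  assumes "linear L"
  shows "L x = (\<Sum>b\<in>Basis. (x \<bullet> b) *\<^sub>R L b)"
proof -
  have "L x = L (\<Sum>b\<in>Basis. (x \<bullet> b) *\<^sub>R b)" by (simp add: euclidean_representation)
  also have "\<dots> = (\<Sum>b\<in>Basis. (x \<bullet> b) *\<^sub>R L b)"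
    using assms by (simp add: linear_sum linear_scale)
  finally show ?thesis .
qed

text \<open>
  The chain rule expresses a directional derivative of \<open>f \<circ> h\<close> through those of \<open>f\<close> along the fixed
  basis vectors, evaluated at \<open>h\<close>; with the direction fixed, the induction hypothesis applies to
  each summand.
\<close>

lemma Ck_on_compose:
  fixes f :: "'b::euclidean_space \<Rightarrow> 'c::euclidean_space" and h :: "'a::euclidean_space \<Rightarrow> 'b"
  assumes "open S" "open S'" "h ` S \<subseteq> S'" "Ck_on k S h" "Ck_on k S' f"
  shows "Ck_on k S (f \<circ> h)"
  using assms(4,5)
proof (induction k arbitrary: f)
  case 0
  then show ?case using assms(3) by (metis Ck_on.simps(1) continuous_on_compose continuous_on_subset)
next
  case (Suc k)
  have dh: "h differentiable (at x)" if "x \<in> S" for x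
    using Suc.prems that by (auto simp: Ck_on_Suc_open assms(1,2) simp del: Ck_on.simps)
  have df: "f differentiable (at (h x))" if "x \<in> S" for x
    using Suc.prems that assms(3) by (auto simp: Ck_on_Suc_open assms(1,2) simp del: Ck_on.simps)
  have e: "frechet_derivative (f \<circ> h) (at x) v =
      (\<Sum>b\<in>Basis. (frechet_derivative h (at x) v \<bullet> b) *\<^sub>R ((\<lambda>y. frechet_derivative f (at y) b) \<circ> h) x)"
    if "x \<in> S" for x v
    unfolding frechet_derivative_compose[OF dh[OF that] df[OF that]] o_apply
    by (rule linear_euclidean_sum[OF linear_frechet_derivative[OF df[OF that]]])
  have "Ck_on k S (\<lambda>x. \<Sum>b\<in>Basis. (frechet_derivative h (at x) v \<bullet> b) *\<^sub>R
      ((\<lambda>y. frechet_derivative f (at y) b) \<circ> h) x)" for v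
    using Suc.prems Ck_on_Suc_imp[OF Suc.prems(1)]
    by (intro Ck_on_sum Ck_on_scaleR Ck_on_inner Suc.IH assms(1)) 
       (auto simp: Ck_on_Suc_open assms(1,2) simp del: Ck_on.simps)
  then have "Ck_on k S (\<lambda>x. frechet_derivative (f \<circ> h) (at x) v)" for v
    using Ck_on_cong[of S "\<lambda>x. frechet_derivative (f \<circ> h) (at x) v"] e by auto
  then show ?case
    using differentiable_chain_at[OF dh df] unfolding Ck_on_Suc_open[OF assms(1)] by blast
qed

lemma smooth_on_compose:
  "open S \<Longrightarrow> open S' \<Longrightarrow> h ` S \<subseteq> S' \<Longrightarrow> smooth_on S h \<Longrightarrow> smooth_on S' f \<Longrightarrow> smooth_on S (f \<circ> h)"
  using Ck_on_compose unfolding smooth_on_def by metis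

lemma smooth_on_cong:
  "(\<And>x. x \<in> S \<Longrightarrow> f x = g x) \<Longrightarrow> smooth_on S f \<longleftrightarrow> smooth_on S g"
  unfolding smooth_on_def using Ck_on_cong[of S f g] by blast

lemma smooth_on_subset:
  "open S \<Longrightarrow> open S' \<Longrightarrow> S' \<subseteq> S \<Longrightarrow> smooth_on S f \<Longrightarrow> smooth_on S' f"
  unfolding smooth_on_def using Ck_on_subset by blast

lemma smooth_on_differentiable:
  assumes "open S" "smooth_on S f" "x \<in> S"
  shows "f differentiable (at x)"
  using assms unfolding smooth_on_def by (metis Ck_on_Suc_open)

lemma smooth_on_derivative:
  assumes "open S" "smooth_on S f"
  shows "smooth_on S (\<lambda>x. frechet_derivative f (at x) v)"
  using assms unfolding smooth_on_def by (metis Ck_on_Suc_open)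

lemma smooth_on_affine:
  assumes "bounded_linear L" "open S"
  shows "smooth_on S (\<lambda>x. L x + c)"
  unfolding smooth_on_def by (intro allI Ck_on_add Ck_on_linear Ck_on_const assms)

lemma smooth_on_imp_continuous_on: "smooth_on S f \<Longrightarrow> continuous_on S f"
  unfolding smooth_on_def by (metis Ck_on.simps(1))

section \<open>Symmetry of second derivatives\<close>

lemma directional_has_real_derivative:
  fixes f :: "'a::euclidean_space \<Rightarrow> real"
  assumes "f differentiable (at (a + r *\<^sub>R u))"
  shows "((\<lambda>r. f (a + r *\<^sub>R u)) has_real_derivative frechet_derivative f (at (a + r *\<^sub>R u)) u) (at r)"
proof -
  have 1: "((\<lambda>r. a + r *\<^sub>R u) has_derivative (\<lambda>r. r *\<^sub>R u)) (at r)"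
    by (auto intro!: derivative_eq_intros)
  have "((\<lambda>r. f (a + r *\<^sub>R u)) has_derivative
      (\<lambda>r'. frechet_derivative f (at (a + r *\<^sub>R u)) (r' *\<^sub>R u))) (at r)"
    using has_derivative_compose[OF 1, of f] assms[unfolded frechet_derivative_works] by blast
  then show ?thesis
    unfolding has_field_derivative_def
    using linear_frechet_derivative[OF assms] by (simp add: linear_scale mult_commute_abs)
qed

text \<open>
  The mean value theorem twice: first for the increment along \<open>u\<close> of the difference along \<open>v\<close>, then
  for the derivative in the direction \<open>u\<close> along \<open>v\<close>.
\<close>

lemma mixed_second_difference:
  fixes f :: "'a::euclidean_space \<Rightarrow> real"
  assumes S: "open S" "smooth_on S f" and s: "0 < s"
    and seg: "\<And>p q. 0 \<le> p \<Longrightarrow> p \<le> s \<Longrightarrow> 0 \<le> q \<Longrightarrow> q \<le> s \<Longrightarrow> z + p *\<^sub>R u + q *\<^sub>R v \<in> S"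
  obtains p q where "0 < p" "p < s" "0 < q" "q < s"
    "f (z + s *\<^sub>R u + s *\<^sub>R v) - f (z + s *\<^sub>R u) - f (z + s *\<^sub>R v) + f z =
      s * s * frechet_derivative (\<lambda>x. frechet_derivative f (at x) u) (at (z + p *\<^sub>R u + q *\<^sub>R v)) v"
proof -
  define h where "h r = f ((z + s *\<^sub>R v) + r *\<^sub>R u) - f (z + r *\<^sub>R u)" for r
  let ?Du = "\<lambda>x. frechet_derivative f (at x) u"
  have seg0: "z + p *\<^sub>R u \<in> S" if "0 \<le> p" "p \<le> s" for p
    using seg[of p 0] that s by simp
  have seg1: "(z + s *\<^sub>R v) + p *\<^sub>R u \<in> S" if "0 \<le> p" "p \<le> s" for p
    using seg[of p s] that s by (simp add: algebra_simps)
  have dh: "(h has_real_derivative ?Du ((z + s *\<^sub>R v) + r *\<^sub>R u) - ?Du (z + r *\<^sub>R u)) (at r)"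
    if "0 \<le> r" "r \<le> s" for r
    unfolding h_def
    by (intro DERIV_diff directional_has_real_derivative smooth_on_differentiable[OF S] seg0 seg1 that)
  obtain p where p: "0 < p" "p < s" "h s - h 0 = (s - 0) * (?Du ((z + s *\<^sub>R v) + p *\<^sub>R u) - ?Du (z + p *\<^sub>R u))"
    using MVT2[OF s, of h, OF dh] by blast
  have dk: "((\<lambda>r. ?Du ((z + p *\<^sub>R u) + r *\<^sub>R v)) has_real_derivative
      frechet_derivative ?Du (at ((z + p *\<^sub>R u) + r *\<^sub>R v)) v) (at r)" if "0 \<le> r" "r \<le> s" for r
    using p that by (intro directional_has_real_derivative smooth_on_differentiable[OF S(1) smooth_on_derivative[OF S]] seg) auto
  obtain q where q: "0 < q" "q < s" "?Du ((z + p *\<^sub>R u) + s *\<^sub>R v) - ?Du ((z + p *\<^sub>R u) + 0 *\<^sub>R v)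
     = (s - 0) * frechet_derivative ?Du (at ((z + p *\<^sub>R u) + q *\<^sub>R v)) v"
    using MVT2[OF s, of "\<lambda>r. ?Du ((z + p *\<^sub>R u) + r *\<^sub>R v)", OF dk] by blast
  show ?thesis
    using that[OF p(1,2) q(1,2)] p(3) q(3) unfolding h_def by (simp add: algebra_simps)
qed

text \<open>
  Schwarz's theorem.  The second difference is symmetric in \<open>u\<close> and \<open>v\<close>, so on every small
  parallelogram at \<open>z\<close> the two mixed derivatives take a common value, at possibly different points;
  continuity leaves no gap between them at \<open>z\<close>.
\<close>

lemma symmetric_second_derivative:
  fixes f :: "'a::euclidean_space \<Rightarrow> real"
  assumes S: "open S" "smooth_on S f" and z: "z \<in> S"
  shows "frechet_derivative (\<lambda>x. frechet_derivative f (at x) u) (at z) v =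
         frechet_derivative (\<lambda>x. frechet_derivative f (at x) v) (at z) u"
    (is "?A z = ?B z")
proof (rule ccontr)
  assume ne: "?A z \<noteq> ?B z"
  define e where "e = \<bar>?A z - ?B z\<bar> / 2"
  have e: "e > 0" using ne by (simp add: e_def)
  have "isCont ?A z" "isCont ?B z"
    using smooth_on_imp_continuous_on[OF smooth_on_derivative[OF S(1) smooth_on_derivative[OF S]]]
      S(1) z continuous_on_eq_continuous_at by blast+
  then obtain d1 d2 where d: "d1 > 0" "d2 > 0" "\<And>x. dist x z < d1 \<Longrightarrow> dist (?A x) (?A z) < e"
     "\<And>x. dist x z < d2 \<Longrightarrow> dist (?B x) (?B z) < e"
    using e unfolding continuous_at_eps_delta by metis
  obtain d3 where d3: "d3 > 0" "ball z d3 \<subseteq> S" using S(1) z openE by blast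
  define d where "d = min d1 (min d2 d3)"
  \<comment> \<open>side length for which the whole parallelogram lies in the ball of radius \<open>d\<close>\<close>
  define s where "s = d / (2 * (norm u + norm v + 1))"
  have dpos: "d > 0" using d d3 by (simp add: d_def)
  have den: "norm u + norm v + 1 > 0" by (simp add: add_nonneg_pos)
  have spos: "s > 0" using dpos den by (simp add: s_def)
  have near: "dist (z + p *\<^sub>R u + q *\<^sub>R v) z < d" if "0 \<le> p" "p \<le> s" "0 \<le> q" "q \<le> s" for p q
  proof -
    have "dist (z + p *\<^sub>R u + q *\<^sub>R v) z \<le> p * norm u + q * norm v"
      using norm_triangle_ineq[of "p *\<^sub>R u" "q *\<^sub>R v"] that by (simp add: dist_norm add.assoc)
    also have "\<dots> \<le> s * norm u + s * norm v"
      using that by (intro add_mono mult_right_mono) auto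
    also have "\<dots> < 2 * (s * (norm u + norm v + 1))"
      using mult_pos_pos[OF spos den] spos by (simp add: algebra_simps)
    also have "\<dots> = d" using den by (simp add: s_def field_simps)
    finally show ?thesis .
  qed
  have in_S: "z + p *\<^sub>R u + q *\<^sub>R v \<in> S" if "0 \<le> p" "p \<le> s" "0 \<le> q" "q \<le> s" for p q
    using near[OF that] d3 by (auto simp: d_def dist_commute)
  obtain p q where pq: "0 < p" "p < s" "0 < q" "q < s"
    "f (z + s *\<^sub>R u + s *\<^sub>R v) - f (z + s *\<^sub>R u) - f (z + s *\<^sub>R v) + f z = s * s * ?A (z + p *\<^sub>R u + q *\<^sub>R v)"
    using mixed_second_difference[OF S spos, of z u v] in_S by blast
  have in_S': "z + p *\<^sub>R v + q *\<^sub>R u \<in> S" if "0 \<le> p" "p \<le> s" "0 \<le> q" "q \<le> s" for p q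
    using in_S[OF that(3,4,1,2)] by (simp add: algebra_simps)
  obtain p' q' where pq': "0 < p'" "p' < s" "0 < q'" "q' < s"
    "f (z + s *\<^sub>R v + s *\<^sub>R u) - f (z + s *\<^sub>R v) - f (z + s *\<^sub>R u) + f z = s * s * ?B (z + p' *\<^sub>R v + q' *\<^sub>R u)"
    using mixed_second_difference[OF S spos, of z v u] in_S' by blast
  have "?A (z + p *\<^sub>R u + q *\<^sub>R v) = ?B (z + p' *\<^sub>R v + q' *\<^sub>R u)"
    using pq(5) pq'(5) spos by (simp add: algebra_simps)
  moreover have "dist (?A (z + p *\<^sub>R u + q *\<^sub>R v)) (?A z) < e"
    using near[of p q] pq by (intro d) (auto simp: d_def)
  moreover have "dist (?B (z + p' *\<^sub>R v + q' *\<^sub>R u)) (?B z) < e"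
    using near[of q' p'] pq' by (intro d) (auto simp: d_def algebra_simps)
  ultimately have "\<bar>?A z - ?B z\<bar> < e + e"
    using abs_triangle_ineq4 unfolding dist_real_def by linarith
  then show False
    unfolding e_def by simp
qed

section \<open>Tangent vectors in a chart\<close>

text \<open>
  The tangent vector at \<open>p\<close> with coordinates \<open>w\<close> in the chart \<open>\<phi>\<close>.  As for velocities, it vanishes on
  functions that are not smooth near \<open>p\<close>, so that equality of functionals is equality of vectors.
\<close>

definition coord_vector ::
    "'g::topological_space chart set \<Rightarrow> 'g set \<Rightarrow> ('g \<Rightarrow> real^3) \<Rightarrow> 'g \<Rightarrow> real^3 \<Rightarrow> 'g tvec" where
  "coord_vector A U \<phi> p w =
     (\<lambda>f. if smooth_near A p f then frechet_derivative (f \<circ> inv_into U \<phi>) (at (\<phi> p)) w else 0)"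

lemma chart_props:
  assumes "smooth_atlas A" "(U, \<phi>) \<in> A"
  shows chart_open: "open U" and chart_image_open: "open (\<phi> ` U)"
    and chart_inv_continuous: "continuous_on (\<phi> ` U) (inv_into U \<phi>)"
    and chart_inv: "\<And>x. x \<in> U \<Longrightarrow> inv_into U \<phi> (\<phi> x) = x"
proof -
  have *: "open U \<and> open (\<phi> ` U) \<and> homeomorphism U (\<phi> ` U) \<phi> (inv_into U \<phi>)"
    using bspec[OF assms(1)[unfolded smooth_atlas_def, THEN conjunct2, THEN conjunct1] assms(2)] by simp
  then show "open U" "open (\<phi> ` U)" "continuous_on (\<phi> ` U) (inv_into U \<phi>)"
    "\<And>x. x \<in> U \<Longrightarrow> inv_into U \<phi> (\<phi> x) = x"
    by (auto simp: homeomorphism_def)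
qed

lemma chart_at:
  assumes "smooth_atlas A"
  obtains U \<phi> where "(U, \<phi>) \<in> A" "p \<in> U"
proof -
  have "p \<in> (\<Union>(U, \<phi>)\<in>A. U)"
    using assms[unfolded smooth_atlas_def, THEN conjunct1] by simp
  then show ?thesis using that by auto
qed

lemma chart_image_open_Int:
  assumes "smooth_atlas A" "(U, \<phi>) \<in> A" "open W"
  shows "open (\<phi> ` (U \<inter> W))"
proof -
  have "\<phi> ` (U \<inter> W) = \<phi> ` U \<inter> inv_into U \<phi> -` W"
    by (auto simp: chart_inv[OF assms(1,2)])
  then show ?thesis
    using continuous_open_preimage[OF chart_inv_continuous[OF assms(1,2)] chart_image_open[OF assms(1,2)] assms(3)]
    by simp
qed

lemma transition_smooth:
  assumes "smooth_atlas A" "(U, \<phi>) \<in> A" "(V, \<psi>) \<in> A"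
  shows "smooth_on (\<phi> ` (U \<inter> V)) (\<psi> \<circ> inv_into U \<phi>)"
  using bspec[OF bspec[OF assms(1)[unfolded smooth_atlas_def, THEN conjunct2, THEN conjunct2] assms(2), unfolded split] assms(3)]
  by simp

lemma smooth_near_chart:
  assumes "smooth_atlas A" "(U, \<phi>) \<in> A" "smooth_near A p f" "p \<in> U"
  obtains W where "open W" "p \<in> W" "W \<subseteq> U" "open (\<phi> ` W)" "smooth_on (\<phi> ` W) (f \<circ> inv_into U \<phi>)"
proof -
  obtain W where W: "open W" "p \<in> W" "smooth_on (\<phi> ` (U \<inter> W)) (f \<circ> inv_into U \<phi>)"
    using assms(2,3) unfolding smooth_near_def by fast
  show ?thesis
    using that[of "U \<inter> W"] W chart_open[OF assms(1,2)] chart_image_open_Int[OF assms(1,2) W(1)] assms(4)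
    by (auto simp: open_Int)
qed

lemma smooth_near_open:
  assumes "smooth_near A p f"
  obtains W where "open W" "p \<in> W" "\<And>q. q \<in> W \<Longrightarrow> smooth_near A q f"
proof -
  obtain W where W: "open W" "p \<in> W" "\<forall>(U, \<phi>)\<in>A. smooth_on (\<phi> ` (U \<inter> W)) (f \<circ> inv_into U \<phi>)"
    using assms[unfolded smooth_near_def] by (elim exE conjE) (rule that)
  then have "smooth_near A q f" if "q \<in> W" for q
    unfolding smooth_near_def using that by (intro exI[of _ W]) simp
  with W show ?thesis using that by blast
qed

lemma smooth_near_differentiable:
  assumes "smooth_atlas A" "(U, \<phi>) \<in> A" "smooth_near A p f" "p \<in> U"
  shows "(f \<circ> inv_into U \<phi>) differentiable (at (\<phi> p))"
proof -
  obtain W where "p \<in> W" and W: "open (\<phi> ` W)" "smooth_on (\<phi> ` W) (f \<circ> inv_into U \<phi>)"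
    using smooth_near_chart[OF assms] .
  then show ?thesis
    using smooth_on_differentiable[OF W] by blast
qed

text \<open>
  Smoothness near a point is local, so the values of \<open>\<phi>\<close> outside its chart are harmless.
\<close>

lemma smooth_near_coordinate:
  assumes A: "smooth_atlas A" and c: "(U, \<phi>) \<in> A" and "p \<in> U"
  shows "smooth_near A p (\<lambda>x. \<phi> x \<bullet> d)"
proof -
  have "smooth_on (\<psi> ` (V \<inter> U)) ((\<lambda>x. \<phi> x \<bullet> d) \<circ> inv_into V \<psi>)" if c': "(V, \<psi>) \<in> A" for V \<psi>
    using transition_smooth[OF A c' c] Ck_on_inner[OF chart_image_open_Int[OF A c' chart_open[OF A c]], of _ _ d]
    unfolding smooth_on_def o_def by blast
  then show ?thesis
    unfolding smooth_near_def using chart_open[OF A c] assms(3) by (intro exI[of _ U]) auto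
qed

lemma coord_vector_coordinate:
  assumes A: "smooth_atlas A" and c: "(U, \<phi>) \<in> A" and "p \<in> U"
  shows "coord_vector A U \<phi> p w (\<lambda>x. \<phi> x \<bullet> d) = w \<bullet> d"
proof -
  have "((\<lambda>y. y \<bullet> d) has_derivative (\<lambda>y. y \<bullet> d)) (at (\<phi> p))"
    by (auto intro!: derivative_eq_intros)
  then have "(((\<lambda>x. \<phi> x \<bullet> d) \<circ> inv_into U \<phi>) has_derivative (\<lambda>y. y \<bullet> d)) (at (\<phi> p))"
    by (rule has_derivative_transform_within_open[OF _ chart_image_open[OF A c]])
       (use assms(3) in \<open>auto simp: chart_inv[OF A c]\<close>)
  then show ?thesis
    unfolding coord_vector_def using smooth_near_coordinate[OF assms] frechet_derivative_eqI by fastforce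
qed

lemma coord_vector_const:
  "smooth_atlas A \<Longrightarrow> coord_vector A U \<phi> p w (\<lambda>x. c) = 0"
  unfolding coord_vector_def o_def using frechet_derivative_eqI[OF has_derivative_const, of c]
  by (simp add: fun_eq_iff)

lemma coord_vector_sum:
  assumes "smooth_atlas A" "(U, \<phi>) \<in> A" "p \<in> U"
  shows "coord_vector A U \<phi> p (\<Sum>i\<in>F. a i *\<^sub>R w i) f = (\<Sum>i\<in>F. a i * coord_vector A U \<phi> p (w i) f)"
proof (cases "smooth_near A p f")
  case True
  have "linear (frechet_derivative (f \<circ> inv_into U \<phi>) (at (\<phi> p)))"
    using smooth_near_differentiable[OF assms(1,2) True assms(3)] linear_frechet_derivative by blast
  then show ?thesis
    by (simp add: coord_vector_def True linear_sum linear_scale)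
qed (simp add: coord_vector_def)

lemma open_curve_preimage:
  fixes c :: "real \<Rightarrow> 'g::topological_space"
  assumes "open J" "open U" "continuous_on J c"
  shows "open {t \<in> J. c t \<in> U}"
  using continuous_open_preimage[OF assms(3,1,2)] by (simp add: Int_def vimage_def)

text \<open>
  The chain rule for \<open>f \<circ> \<gamma> = (f \<circ> inv_into U \<phi>) \<circ> (\<phi> \<circ> \<gamma>)\<close>.
\<close>

lemma velocity_coord_vector:
  assumes A: "smooth_atlas A" and c: "(U, \<phi>) \<in> A" and J: "open J" "t \<in> J"
    and \<gamma>: "smooth_curve_on A J \<gamma>" "\<gamma> t \<in> U"
  shows "velocity A J \<gamma> t = coord_vector A U \<phi> (\<gamma> t) (vector_derivative (\<phi> \<circ> \<gamma>) (at t))"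
proof (rule ext)
  fix f
  let ?S = "{t \<in> J. \<gamma> t \<in> U}"
  show "velocity A J \<gamma> t f = coord_vector A U \<phi> (\<gamma> t) (vector_derivative (\<phi> \<circ> \<gamma>) (at t)) f"
  proof (cases "smooth_near A (\<gamma> t) f")
    case True
    have oS: "open ?S"
      using open_curve_preimage[OF J(1) chart_open[OF A c]] \<gamma>(1) by (simp add: smooth_curve_on_def)
    have "smooth_on ?S (\<phi> \<circ> \<gamma>)"
      using \<gamma>(1) c unfolding smooth_curve_on_def by blast
    then have "(\<phi> \<circ> \<gamma>) differentiable (at t)"
      using smooth_on_differentiable[OF oS] J \<gamma>(2) by blast
    then have d1: "((\<phi> \<circ> \<gamma>) has_vector_derivative vector_derivative (\<phi> \<circ> \<gamma>) (at t)) (at t)"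
      using vector_derivative_works by blast
    let ?F = "f \<circ> inv_into U \<phi>"
    have "(?F has_derivative frechet_derivative ?F (at (\<phi> (\<gamma> t)))) (at ((\<phi> \<circ> \<gamma>) t))"
      using smooth_near_differentiable[OF A c True \<gamma>(2)] frechet_derivative_works by auto
    then have "((?F \<circ> (\<phi> \<circ> \<gamma>)) has_vector_derivative
        frechet_derivative ?F (at (\<phi> (\<gamma> t))) (vector_derivative (\<phi> \<circ> \<gamma>) (at t))) (at t)"
      using vector_derivative_diff_chain_within[OF d1] has_derivative_at_withinI by blast
    then have "((f \<circ> \<gamma>) has_vector_derivative
        frechet_derivative ?F (at (\<phi> (\<gamma> t))) (vector_derivative (\<phi> \<circ> \<gamma>) (at t))) (at t)"
      by (rule has_vector_derivative_transform_within_open[OF _ oS]) (use J \<gamma> in \<open>auto simp: chart_inv[OF A c]\<close>)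
    then show ?thesis
      unfolding velocity_def coord_vector_def at_within_open[OF J(2,1)]
      using True by (simp add: vector_derivative_at)
  qed (simp add: velocity_def coord_vector_def)
qed

lemma coord_line_smooth_curve:
  assumes A: "smooth_atlas A" and c: "(U, \<phi>) \<in> A"
    and e: "\<And>t. t \<in> {-e<..<e} \<Longrightarrow> \<phi> p + t *\<^sub>R w \<in> \<phi> ` U"
  shows "smooth_curve_on A {-e<..<e} (\<lambda>t. inv_into U \<phi> (\<phi> p + t *\<^sub>R w))"
    (is "smooth_curve_on A ?J ?c")
proof -
  have bl: "bounded_linear (\<lambda>t. t *\<^sub>R w)" by (rule bounded_linear_scaleR_left)
  have cont: "continuous_on ?J ?c"
    by (rule continuous_on_compose2[OF chart_inv_continuous[OF A c]]) (use e in \<open>auto intro!: continuous_intros\<close>)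
  have "smooth_on {t \<in> ?J. ?c t \<in> V} (\<psi> \<circ> ?c)" if c': "(V, \<psi>) \<in> A" for V \<psi>
  proof -
    let ?S = "{t \<in> ?J. ?c t \<in> V}"
    have oS: "open ?S"
      by (rule open_curve_preimage[OF _ chart_open[OF A c'] cont]) simp
    have l: "smooth_on ?S (\<lambda>t. t *\<^sub>R w + \<phi> p)"
      by (rule smooth_on_affine[OF bl oS])
    have "(\<lambda>t. t *\<^sub>R w + \<phi> p) ` ?S \<subseteq> \<phi> ` (U \<inter> V)"
    proof clarify
      fix t assume t: "t \<in> ?J" "?c t \<in> V"
      then obtain x where "x \<in> U" "\<phi> x = \<phi> p + t *\<^sub>R w" using e by (metis imageE)
      then show "t *\<^sub>R w + \<phi> p \<in> \<phi> ` (U \<inter> V)"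
        using t(2) chart_inv[OF A c, of x] by (metis IntI add.commute image_eqI)
    qed
    then have "smooth_on ?S ((\<psi> \<circ> inv_into U \<phi>) \<circ> (\<lambda>t. t *\<^sub>R w + \<phi> p))"
      by (rule smooth_on_compose[OF oS chart_image_open_Int[OF A c chart_open[OF A c']] _ l transition_smooth[OF A c c']])
    then show ?thesis by (simp add: o_def add.commute)
  qed
  then show ?thesis unfolding smooth_curve_on_def using cont by blast
qed

lemma chart_small_segment:
  assumes A: "smooth_atlas A" and c: "(U, \<phi>) \<in> A" "p \<in> U"
  obtains e where "e > 0" "\<And>t. \<bar>t\<bar> < e \<Longrightarrow> \<phi> p + t *\<^sub>R w \<in> \<phi> ` U"
proof -
  have "isCont (\<lambda>t. \<phi> p + t *\<^sub>R w) 0" by (intro continuous_intros)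
  moreover have "\<phi> p + 0 *\<^sub>R w \<in> \<phi> ` U" using c by auto
  ultimately have "\<forall>\<^sub>F t in nhds 0. \<phi> p + t *\<^sub>R w \<in> \<phi> ` U"
    using chart_image_open[OF A c(1)] by (simp add: isCont_def tendsto_def eventually_nhds_conv_at)
  then show ?thesis
    unfolding eventually_nhds_metric using that by (auto simp: dist_real_def)
qed

text \<open>
  Every coordinate vector is a velocity, namely that of a straight line in the chart.  This makes
  the tangent space, which is defined by curves, closed under linear combinations.
\<close>

lemma tangent_space_eq:
  assumes A: "smooth_atlas A" and c: "(U, \<phi>) \<in> A" and p: "p \<in> U"
  shows "tangent_space A p = range (coord_vector A U \<phi> p)"
proof
  show "tangent_space A p \<subseteq> range (coord_vector A U \<phi> p)"
  proof
    fix v assume "v \<in> tangent_space A p"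
    then obtain \<gamma> e where "v = velocity A {-e<..<e} \<gamma> 0" "(0::real) < e" "smooth_curve_on A {-e<..<e} \<gamma>" "\<gamma> 0 = p"
      unfolding tangent_space_def by blast
    then show "v \<in> range (coord_vector A U \<phi> p)"
      using velocity_coord_vector[OF A c, of "{-e<..<e}" 0 \<gamma>] p by auto
  qed
  show "range (coord_vector A U \<phi> p) \<subseteq> tangent_space A p"
  proof clarify
    fix w
    obtain e where e: "e > 0" "\<And>t. \<bar>t\<bar> < e \<Longrightarrow> \<phi> p + t *\<^sub>R w \<in> \<phi> ` U"
      using chart_small_segment[OF A c p] by blast
    let ?c = "\<lambda>t. inv_into U \<phi> (\<phi> p + t *\<^sub>R w)"
    have e': "\<phi> p + t *\<^sub>R w \<in> \<phi> ` U" if "t \<in> {-e<..<e}" for t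
      using e(2)[of t] that by auto
    have sc: "smooth_curve_on A {-e<..<e} ?c"
      by (rule coord_line_smooth_curve[OF A c e'])
    have c0: "?c 0 = p" using chart_inv[OF A c p] by simp
    have "((\<lambda>t. \<phi> p + t *\<^sub>R w) has_vector_derivative w) (at 0)"
      by (auto intro!: derivative_eq_intros simp: has_vector_derivative_def)
    then have "((\<phi> \<circ> ?c) has_vector_derivative w) (at 0)"
      by (rule has_vector_derivative_transform_within_open[of _ _ _ "{-e<..<e}"])
         (use e(1) e' in \<open>auto simp: f_inv_into_f\<close>)
    then have "velocity A {-e<..<e} ?c 0 = coord_vector A U \<phi> p w"
      using velocity_coord_vector[OF A c, of "{-e<..<e}" 0 ?c] sc c0 p e(1) vector_derivative_at by fastforce
    then show "coord_vector A U \<phi> p w \<in> tangent_space A p"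
      unfolding tangent_space_def using e(1) sc c0 by force
  qed
qed

lemma tangent_vector_const:
  assumes "smooth_atlas A" "v \<in> tangent_space A p"
  shows "v (\<lambda>x. c) = 0"
proof -
  obtain U \<phi> where "(U, \<phi>) \<in> A" "p \<in> U" using chart_at[OF assms(1)] .
  then show ?thesis
    using assms(2) coord_vector_const[OF assms(1)] tangent_space_eq[OF assms(1)] by auto
qed

lemma tangent_vector_not_smooth:
  assumes "smooth_atlas A" "v \<in> tangent_space A p" "\<not> smooth_near A p f"
  shows "v f = 0"
proof -
  obtain U \<phi> where "(U, \<phi>) \<in> A" "p \<in> U" using chart_at[OF assms(1)] .
  then show ?thesis
    using assms(2,3) tangent_space_eq[OF assms(1)] by (auto simp: coord_vector_def)
qed

lemma tangent_space_sum:
  assumes "smooth_atlas A" "\<And>i. i \<in> F \<Longrightarrow> v i \<in> tangent_space A p"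
  shows "(\<lambda>f. \<Sum>i\<in>F. a i * v i f) \<in> tangent_space A p"
proof -
  obtain U \<phi> where c: "(U, \<phi>) \<in> A" "p \<in> U" using chart_at[OF assms(1)] .
  then have "\<forall>i\<in>F. \<exists>w. v i = coord_vector A U \<phi> p w"
    using assms(2) unfolding tangent_space_eq[OF assms(1) c] by blast
  then obtain w where w: "\<forall>i\<in>F. v i = coord_vector A U \<phi> p (w i)" by metis
  have "(\<lambda>f. \<Sum>i\<in>F. a i * v i f) = coord_vector A U \<phi> p (\<Sum>i\<in>F. a i *\<^sub>R w i)"
    using w by (simp add: fun_eq_iff coord_vector_sum[OF assms(1) c])
  then show ?thesis
    using tangent_space_eq[OF assms(1) c] by auto
qed

section \<open>Smooth maps and push-forwards\<close>

text \<open>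
  The continuity requirement makes the sets \<open>U \<inter> F -` V\<close> open, so that the smoothness of the local
  expressions is meaningful.
\<close>

definition smooth_map :: "'g::topological_space chart set \<Rightarrow> ('g \<Rightarrow> 'g) \<Rightarrow> bool" where
  "smooth_map A F \<longleftrightarrow> continuous_on UNIV F \<and>
     (\<forall>(U, \<phi>)\<in>A. \<forall>(V, \<psi>)\<in>A. smooth_on (\<phi> ` (U \<inter> F -` V)) (\<psi> \<circ> F \<circ> inv_into U \<phi>))"

lemma smooth_map_vimage_open: "smooth_map A F \<Longrightarrow> open V \<Longrightarrow> open (F -` V)"
  unfolding smooth_map_def using open_vimage by blast

lemma smooth_near_compose:
  assumes A: "smooth_atlas A" and F: "smooth_map A F" and f: "smooth_near A (F p) f"
  shows "smooth_near A p (f \<circ> F)"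
proof -
  obtain V \<psi> where c': "(V, \<psi>) \<in> A" "F p \<in> V" using chart_at[OF A] .
  obtain W where W: "open W" "F p \<in> W" "W \<subseteq> V" "open (\<psi> ` W)" "smooth_on (\<psi> ` W) (f \<circ> inv_into V \<psi>)"
    using smooth_near_chart[OF A c'(1) f c'(2)] .
  have o: "open (F -` W)" "open (F -` V)"
    using smooth_map_vimage_open[OF F] W(1) chart_open[OF A c'(1)] by auto
  have "smooth_on (\<phi> ` (U \<inter> F -` W)) (f \<circ> F \<circ> inv_into U \<phi>)" if c: "(U, \<phi>) \<in> A" for U \<phi>
  proof -
    have "smooth_on (\<phi> ` (U \<inter> F -` V)) (\<psi> \<circ> F \<circ> inv_into U \<phi>)"
      using F c c'(1) unfolding smooth_map_def by blast
    then have 1: "smooth_on (\<phi> ` (U \<inter> F -` W)) (\<psi> \<circ> F \<circ> inv_into U \<phi>)"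
      by (rule smooth_on_subset[rotated 3]) (use o W(3) in \<open>auto intro!: chart_image_open_Int[OF A c]\<close>)
    have "(\<psi> \<circ> F \<circ> inv_into U \<phi>) ` (\<phi> ` (U \<inter> F -` W)) \<subseteq> \<psi> ` W"
      by (auto simp: chart_inv[OF A c])
    then have "smooth_on (\<phi> ` (U \<inter> F -` W)) ((f \<circ> inv_into V \<psi>) \<circ> (\<psi> \<circ> F \<circ> inv_into U \<phi>))"
      by (rule smooth_on_compose[OF chart_image_open_Int[OF A c o(1)] W(4) _ 1 W(5)])
    moreover have "((f \<circ> inv_into V \<psi>) \<circ> (\<psi> \<circ> F \<circ> inv_into U \<phi>)) y = (f \<circ> F \<circ> inv_into U \<phi>) y"
      if "y \<in> \<phi> ` (U \<inter> F -` W)" for y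
      using that W(3) by (auto simp: chart_inv[OF A c] chart_inv[OF A c'(1)] subset_iff)
    ultimately show ?thesis using smooth_on_cong by blast
  qed
  then show ?thesis
    unfolding smooth_near_def using o W by (intro exI[of _ "F -` W"]) auto
qed

text \<open>
  The inverse \<open>F'\<close> is there for the functions that are not smooth near \<open>F p\<close>: composing with \<open>F\<close>
  cannot make them smooth, so the push-forward also vanishes on them.
\<close>

lemma pushforward_tangent_space:
  assumes A: "smooth_atlas A" and F: "smooth_map A F" "smooth_map A F'" "\<And>x. F' (F x) = x" "\<And>x. F (F' x) = x"
    and v: "v \<in> tangent_space A p"
  shows "pushforward F v \<in> tangent_space A (F p)"
proof -
  obtain U \<phi> where c: "(U, \<phi>) \<in> A" "p \<in> U" using chart_at[OF A] .
  obtain V \<psi> where c': "(V, \<psi>) \<in> A" "F p \<in> V" using chart_at[OF A] .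
  obtain w where w: "v = coord_vector A U \<phi> p w" using v tangent_space_eq[OF A c] by auto
  let ?G = "\<psi> \<circ> F \<circ> inv_into U \<phi>"
  let ?w = "frechet_derivative ?G (at (\<phi> p)) w"
  have oV: "open (F -` V)" using smooth_map_vimage_open[OF F(1)] chart_open[OF A c'(1)] by blast
  have dG: "?G differentiable (at (\<phi> p))"
    using F(1) c c' unfolding smooth_map_def
    by (intro smooth_on_differentiable[OF chart_image_open_Int[OF A c(1) oV]]) auto
  have "pushforward F v f = coord_vector A V \<psi> (F p) ?w f" for f
  proof (cases "smooth_near A (F p) f")
    case True
    then have sf: "smooth_near A p (f \<circ> F)" by (rule smooth_near_compose[OF A F(1)])
    have Gp: "?G (\<phi> p) = \<psi> (F p)" using chart_inv[OF A c] by simp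
    have "(f \<circ> inv_into V \<psi>) differentiable (at (?G (\<phi> p)))"
      unfolding Gp by (rule smooth_near_differentiable[OF A c'(1) True c'(2)])
    from frechet_derivative_compose[OF dG this] differentiable_chain_at[OF dG this]
    have "(((f \<circ> inv_into V \<psi>) \<circ> ?G) has_derivative frechet_derivative (f \<circ> inv_into V \<psi>) (at (\<psi> (F p))) \<circ>
        frechet_derivative ?G (at (\<phi> p))) (at (\<phi> p))"
      unfolding Gp frechet_derivative_works by metis
    then have "((f \<circ> F \<circ> inv_into U \<phi>) has_derivative frechet_derivative (f \<circ> inv_into V \<psi>) (at (\<psi> (F p))) \<circ>
        frechet_derivative ?G (at (\<phi> p))) (at (\<phi> p))"
      by (rule has_derivative_transform_within_open[OF _ chart_image_open_Int[OF A c(1) oV]])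
         (use c c' in \<open>auto simp: chart_inv[OF A c(1)] chart_inv[OF A c'(1)]\<close>)
    then show ?thesis
      using sf True unfolding w pushforward_def coord_vector_def by (simp add: frechet_derivative_eqI)
  next
    case False
    have "\<not> smooth_near A p (f \<circ> F)"
    proof
      assume "smooth_near A p (f \<circ> F)"
      then have "smooth_near A (F p) ((f \<circ> F) \<circ> F')"
        using smooth_near_compose[OF A F(2), of "F p" "f \<circ> F"] F(3) by simp
      then show False using False F(4) by (simp add: o_def)
    qed
    then show ?thesis
      using False unfolding w pushforward_def coord_vector_def by simp
  qed
  then show ?thesis
    using tangent_space_eq[OF A c'] by (metis ext rangeI)
qed

section \<open>Derivatives of solutions of linear systems\<close>

text \<open>
  If \<open>L = M y\<close> with \<open>L\<close> and \<open>M\<close> differentiable at \<open>0\<close> and \<open>M 0\<close> the identity, a bounded solution \<open>y\<close>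
  is differentiable at \<open>0\<close>.  Writing \<open>y t - y 0 = (L t - M t y 0) - (M t - M 0) (y t - y 0)\<close> avoids
  inverting \<open>M t\<close>: boundedness gives continuity of \<open>y\<close> first, and then the last term is of smaller
  order.
\<close>

lemma derivative_of_linear_system_solution:
  fixes M :: "'n::finite \<Rightarrow> 'n \<Rightarrow> real \<Rightarrow> real" and y L :: "'n \<Rightarrow> real \<Rightarrow> real"
  assumes sys: "\<And>l t. L l t = (\<Sum>k\<in>UNIV. M l k t * y k t)"
    and M0: "\<And>l k. M l k 0 = (if l = k then 1 else 0)"
    and bnd: "\<And>k t. \<bar>y k t\<bar> \<le> 1"
    and dL: "\<And>l. (L l has_real_derivative L' l) (at 0)"
    and dM: "\<And>l k. (M l k has_real_derivative M' l k) (at 0)"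
  shows "(y l has_real_derivative L' l - (\<Sum>k\<in>UNIV. M' l k * y k 0)) (at 0)"
proof -
  define P where "P l t = L l t - (\<Sum>k\<in>UNIV. M l k t * y k 0)" for l t
  have P0: "P l 0 = 0" for l by (simp add: P_def sys)
  have dP: "(P l has_real_derivative L' l - (\<Sum>k\<in>UNIV. M' l k * y k 0)) (at 0)" for l
    unfolding P_def by (intro DERIV_diff dL DERIV_sum DERIV_cmult_right dM)
  have split: "y l t - y l 0 = P l t - (\<Sum>k\<in>UNIV. (M l k t - M l k 0) * (y k t - y k 0))" for l t
  proof -
    have "(\<Sum>k\<in>UNIV. M l k 0 * (y k t - y k 0)) = y l t - y l 0"
      by (simp add: M0 if_distrib[of "\<lambda>x. x * _"] cong: if_cong)
    then show ?thesis
      by (simp add: P_def sys left_diff_distrib right_diff_distrib sum_subtractf)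
  qed
  have cont: "((\<lambda>t. y l t - y l 0) \<longlongrightarrow> 0) (at 0)" for l
  proof -
    have Pl: "(P l \<longlongrightarrow> 0) (at 0)"
      using DERIV_isCont[OF dP[of l]] P0[of l] by (simp add: isCont_def)
    have prod: "((\<lambda>t. (M l k t - M l k 0) * (y k t - y k 0)) \<longlongrightarrow> 0) (at 0)" for k
    proof (rule Lim_null_comparison)
      show "((\<lambda>t. \<bar>M l k t - M l k 0\<bar> * 2) \<longlongrightarrow> 0) (at 0)"
        using DERIV_isCont[OF dM[of l k]] unfolding isCont_def by (auto intro!: tendsto_eq_intros)
      have "\<bar>y k t - y k 0\<bar> \<le> 2" for t
        using bnd[of k t] bnd[of k 0] by linarith
      then show "\<forall>\<^sub>F t in at 0. norm ((M l k t - M l k 0) * (y k t - y k 0)) \<le> \<bar>M l k t - M l k 0\<bar> * 2"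
        by (auto simp: abs_mult intro!: mult_left_mono always_eventually)
    qed
    have "((\<lambda>t. P l t - (\<Sum>k\<in>UNIV. (M l k t - M l k 0) * (y k t - y k 0))) \<longlongrightarrow> 0 - (\<Sum>k\<in>(UNIV::'n set). 0)) (at 0)"
      by (rule tendsto_diff[OF Pl tendsto_sum[OF prod]])
    then show ?thesis unfolding split[of l] by simp
  qed
  have "((\<lambda>t. (P l t - P l 0) / (t - 0) - (\<Sum>k\<in>UNIV. (M l k t - M l k 0) / (t - 0) * (y k t - y k 0)))
      \<longlongrightarrow> (L' l - (\<Sum>k\<in>UNIV. M' l k * y k 0)) - (\<Sum>k\<in>UNIV. M' l k * 0)) (at 0)"
    using dP dM cont by (intro tendsto_diff tendsto_sum tendsto_mult) (auto simp: has_field_derivative_iff)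
  moreover have "(P l t - P l 0) / (t - 0) - (\<Sum>k\<in>UNIV. (M l k t - M l k 0) / (t - 0) * (y k t - y k 0))
     = (y l t - y l 0) / (t - 0)" for t
    unfolding split[of l t] P0 by (simp add: diff_divide_distrib[of "P l t"] sum_divide_distrib)
  ultimately show ?thesis
    by (simp add: has_field_derivative_iff)
qed

section \<open>Left-invariant orthonormal frames\<close>

locale bi_invariant_lie_group =
  fixes G :: "'g::{t2_space,second_countable_topology} monoid" (structure)
    and A :: "'g chart set"
    and g :: "'g metric"
    and nab :: "'g vfield \<Rightarrow> 'g vfield \<Rightarrow> 'g vfield"
    and X :: "3 \<Rightarrow> 'g vfield"
  assumes lie: "lie_group G A"
    and riem: "riemannian_metric A g"
    and biinv: "bi_invariant G A g"
    and lc: "levi_civita A g nab"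
    and onb: "orthonormal_basis G A g X"
begin

lemma group_G: "group G" and carrier_G [simp]: "carrier G = UNIV" and atlas: "smooth_atlas A"
  and mult_continuous: "continuous_on UNIV (\<lambda>(x, y). x \<otimes> y)"
  using lie by (auto simp: lie_group_def)

lemma mult_chart_smooth:
  assumes "(U, \<phi>) \<in> A" "(V, \<psi>) \<in> A" "(W, \<theta>) \<in> A"
  shows "smooth_on {(x, y). x \<in> \<phi> ` U \<and> y \<in> \<psi> ` V \<and> inv_into U \<phi> x \<otimes> inv_into V \<psi> y \<in> W}
          (\<lambda>(x, y). \<theta> (inv_into U \<phi> x \<otimes> inv_into V \<psi> y))"
proof -
  have "\<forall>(U, \<phi>)\<in>A. \<forall>(V, \<psi>)\<in>A. \<forall>(W, \<theta>)\<in>A.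
        smooth_on {(x, y). x \<in> \<phi> ` U \<and> y \<in> \<psi> ` V \<and> inv_into U \<phi> x \<otimes> inv_into V \<psi> y \<in> W}
          (\<lambda>(x, y). \<theta> (inv_into U \<phi> x \<otimes> inv_into V \<psi> y))"
    using lie unfolding lie_group_def by (elim conjE)
  from bspec[OF bspec[OF bspec[OF this assms(1), unfolded split] assms(2), unfolded split] assms(3), unfolded split]
  show ?thesis .
qed

lemma mult_domain_open:
  assumes c: "(U, \<phi>) \<in> A" and c': "(V, \<psi>) \<in> A" and "open W"
  shows "open {(x, y). x \<in> \<phi> ` U \<and> y \<in> \<psi> ` V \<and> inv_into U \<phi> x \<otimes> inv_into V \<psi> y \<in> W}"
proof -
  let ?D = "\<phi> ` U \<times> \<psi> ` V"
  let ?m = "\<lambda>z. case (inv_into U \<phi> (fst z), inv_into V \<psi> (snd z)) of (x, y) \<Rightarrow> x \<otimes> y"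
  have 1: "continuous_on ?D (\<lambda>z. (inv_into U \<phi> (fst z), inv_into V \<psi> (snd z)))"
    by (intro continuous_on_Pair continuous_on_compose2[OF chart_inv_continuous[OF atlas c]]
        continuous_on_compose2[OF chart_inv_continuous[OF atlas c']] continuous_on_fst continuous_on_snd
        continuous_on_id) auto
  have "continuous_on ?D ?m"
    by (rule continuous_on_compose2[OF mult_continuous 1]) simp
  then have "open (?D \<inter> ?m -` W)"
    by (rule continuous_open_preimage)
      (use assms(3) chart_image_open[OF atlas c] chart_image_open[OF atlas c'] in \<open>auto intro: open_Times\<close>)
  moreover have "?D \<inter> ?m -` W = {(x, y). x \<in> \<phi> ` U \<and> y \<in> \<psi> ` V \<and> inv_into U \<phi> x \<otimes> inv_into V \<psi> y \<in> W}"
    by auto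
  ultimately show ?thesis by simp
qed

lemma smooth_map_left: "smooth_map A (\<lambda>x. h \<otimes> x)"
  unfolding smooth_map_def
proof (intro conjI ballI, safe)
  show "continuous_on UNIV (\<lambda>x. h \<otimes> x)"
    using continuous_on_compose2[OF mult_continuous, of UNIV "\<lambda>x. (h, x)"]
    by (simp add: continuous_on_Pair)
  fix U \<phi> V \<psi> assume c: "(U, \<phi>) \<in> A" and c': "(V, \<psi>) \<in> A"
  obtain E \<epsilon> where e: "(E, \<epsilon>) \<in> A" "h \<in> E" using chart_at[OF atlas] .
  let ?F = "\<lambda>x. h \<otimes> x"
  let ?S = "\<phi> ` (U \<inter> ?F -` V)"
  let ?O = "{(x, y). x \<in> \<epsilon> ` E \<and> y \<in> \<phi> ` U \<and> inv_into E \<epsilon> x \<otimes> inv_into U \<phi> y \<in> V}"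
  have oS: "open ?S"
    by (rule chart_image_open_Int[OF atlas c open_vimage[OF chart_open[OF atlas c']]]) fact
  have l: "smooth_on ?S (\<lambda>y. (0, y) + (\<epsilon> h, 0))"
    by (intro smooth_on_affine oS bounded_linear_Pair bounded_linear_zero bounded_linear_ident)
  have "(\<lambda>y. (0, y) + (\<epsilon> h, 0)) ` ?S \<subseteq> ?O"
    using e by (auto simp: chart_inv[OF atlas e(1)] chart_inv[OF atlas c])
  then have "smooth_on ?S ((\<lambda>(x, y). \<psi> (inv_into E \<epsilon> x \<otimes> inv_into U \<phi> y)) \<circ> (\<lambda>y. (0, y) + (\<epsilon> h, 0)))"
    by (rule smooth_on_compose[OF oS mult_domain_open[OF e(1) c chart_open[OF atlas c']] _ l
        mult_chart_smooth[OF e(1) c c']])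
  then show "smooth_on ?S (\<psi> \<circ> ?F \<circ> inv_into U \<phi>)"
    by (simp add: o_def chart_inv[OF atlas e(1) e(2)])
qed

lemma smooth_map_right: "smooth_map A (\<lambda>x. x \<otimes> h)"
  unfolding smooth_map_def
proof (intro conjI ballI, safe)
  show "continuous_on UNIV (\<lambda>x. x \<otimes> h)"
    using continuous_on_compose2[OF mult_continuous, of UNIV "\<lambda>x. (x, h)"]
    by (simp add: continuous_on_Pair)
  fix U \<phi> V \<psi> assume c: "(U, \<phi>) \<in> A" and c': "(V, \<psi>) \<in> A"
  obtain E \<epsilon> where e: "(E, \<epsilon>) \<in> A" "h \<in> E" using chart_at[OF atlas] .
  let ?F = "\<lambda>x. x \<otimes> h"
  let ?S = "\<phi> ` (U \<inter> ?F -` V)"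
  let ?O = "{(x, y). x \<in> \<phi> ` U \<and> y \<in> \<epsilon> ` E \<and> inv_into U \<phi> x \<otimes> inv_into E \<epsilon> y \<in> V}"
  have oS: "open ?S"
    by (rule chart_image_open_Int[OF atlas c open_vimage[OF chart_open[OF atlas c']]]) fact
  have l: "smooth_on ?S (\<lambda>y. (y, 0) + (0, \<epsilon> h))"
    by (intro smooth_on_affine oS bounded_linear_Pair bounded_linear_zero bounded_linear_ident)
  have "(\<lambda>y. (y, 0) + (0, \<epsilon> h)) ` ?S \<subseteq> ?O"
    using e by (auto simp: chart_inv[OF atlas e(1)] chart_inv[OF atlas c])
  then have "smooth_on ?S ((\<lambda>(x, y). \<psi> (inv_into U \<phi> x \<otimes> inv_into E \<epsilon> y)) \<circ> (\<lambda>y. (y, 0) + (0, \<epsilon> h)))"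
    by (rule smooth_on_compose[OF oS mult_domain_open[OF c e(1) chart_open[OF atlas c']] _ l
        mult_chart_smooth[OF c e(1) c']])
  then show "smooth_on ?S (\<psi> \<circ> ?F \<circ> inv_into U \<phi>)"
    by (simp add: o_def chart_inv[OF atlas e(1) e(2)])
qed

interpretation group G by (rule group_G)

lemma frame_left_invariant: "X i \<in> left_invariant_fields G A"
  and frame_orthonormal: "g p (X i p) (X j p) = (if i = j then 1 else 0)"
  using onb by (auto simp: orthonormal_basis_def)

lemma frame_vector_field: "X i \<in> vector_fields A"
  and frame_left_translate: "X i (h \<otimes> p) f = X i p (f \<circ> (\<lambda>x. h \<otimes> x))"
  using frame_left_invariant[of i] by (auto simp: left_invariant_fields_def pushforward_def)

lemma frame_tangent: "X i p \<in> tangent_space A p"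
  and frame_smooth: "smooth_near A p f \<Longrightarrow> smooth_near A p (\<lambda>q. X i q f)"
  using frame_vector_field[of i] by (auto simp: vector_fields_def)

lemma metric_sym: "u \<in> tangent_space A p \<Longrightarrow> v \<in> tangent_space A p \<Longrightarrow> g p u v = g p v u"
  using riem by (simp add: riemannian_metric_def)

lemma metric_linear:
  assumes "u \<in> tangent_space A p" "v \<in> tangent_space A p" "w \<in> tangent_space A p"
  shows "g p (\<lambda>f. a * u f + b * v f) w = a * g p u w + b * g p v w"
  using riem assms unfolding riemannian_metric_def by blast

lemma metric_zero: "w \<in> tangent_space A p \<Longrightarrow> g p (\<lambda>f. 0) w = 0"
  using metric_linear[of w p w w 0 0] by simp

lemma metric_sum:
  assumes "finite F" "\<And>i. i \<in> F \<Longrightarrow> v i \<in> tangent_space A p" "w \<in> tangent_space A p"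
  shows "g p (\<lambda>f. \<Sum>i\<in>F. a i * v i f) w = (\<Sum>i\<in>F. a i * g p (v i) w)"
  using assms(1,2)
proof (induction F)
  case empty
  then show ?case using metric_zero[OF assms(3)] by simp
next
  case (insert i F)
  have "(\<lambda>f. \<Sum>i\<in>F. a i * v i f) \<in> tangent_space A p"
    by (rule tangent_space_sum[OF atlas]) (use insert in auto)
  then show ?case
    using metric_linear[of "v i" p "\<lambda>f. \<Sum>i\<in>F. a i * v i f" w "a i" 1] insert assms(3) by simp
qed

lemma metric_frame_sum: "g p (\<lambda>f. \<Sum>i\<in>UNIV. a i * X i p f) (X k p) = a k"
  by (subst metric_sum) (auto simp: frame_tangent frame_orthonormal if_distrib cong: if_cong)

text \<open>
  Orthonormality makes the three frame vectors independent as functionals, so their coordinates in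
  a chart form an invertible matrix.  Its inverse yields both the expansion of tangent vectors in
  the frame and functions dual to the frame.
\<close>

lemma frame_matrix:
  assumes c: "(U, \<phi>) \<in> A" "p \<in> U"
  obtains W B :: "real^3^3" where "\<And>k. X k p = coord_vector A U \<phi> p (row k W)"
    "W ** B = mat 1" "B ** W = mat 1"
proof -
  have "\<forall>k. \<exists>w. X k p = coord_vector A U \<phi> p w"
    using frame_tangent tangent_space_eq[OF atlas c] by blast
  then obtain w where w: "\<And>k. X k p = coord_vector A U \<phi> p (w k)" by metis
  define W :: "real^3^3" where "W = (\<chi> k. w k)"
  have row: "row k W = w k" for k by (simp add: W_def row_def vec_eq_iff)
  have "\<forall>i. a i = 0" if "(\<Sum>i\<in>UNIV. a i *s row i W) = 0" for a
  proof -
    have 0: "(\<Sum>i\<in>UNIV. a i *\<^sub>R w i) = 0" using that by (simp add: row scalar_mult_eq_scaleR)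
    have "(\<lambda>f. \<Sum>i\<in>UNIV. a i * X i p f) = (\<lambda>f. 0)"
    proof
      fix f
      have "(\<Sum>i\<in>UNIV. a i * X i p f) = coord_vector A U \<phi> p 0 f"
        using coord_vector_sum[OF atlas c, where F=UNIV and a=a and w=w and f=f] w 0 by simp
      also have "\<dots> = 0"
        using coord_vector_sum[OF atlas c, where F="{}::nat set"] by simp
      finally show "(\<Sum>i\<in>UNIV. a i * X i p f) = 0" .
    qed
    then show ?thesis
      using metric_frame_sum[of p a] metric_zero[OF frame_tangent] by simp
  qed
  then obtain B where "W ** B = mat 1"
    using matrix_right_invertible_independent_rows[of W] by blast
  then show ?thesis
    using that[of W B] w row matrix_left_right_inverse[of W B] by simp
qed

lemma frame_expansion:
  assumes v: "v \<in> tangent_space A p"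
  shows "v = (\<lambda>f. \<Sum>k\<in>UNIV. g p v (X k p) * X k p f)"
proof -
  obtain U \<phi> where c: "(U, \<phi>) \<in> A" "p \<in> U" using chart_at[OF atlas] .
  obtain W B :: "real^3^3" where W: "\<And>k. X k p = coord_vector A U \<phi> p (row k W)" "B ** W = mat 1"
    using frame_matrix[OF c] by metis
  obtain w where w: "v = coord_vector A U \<phi> p w" using v tangent_space_eq[OF atlas c] by auto
  have "w = (w v* B) v* W"
    by (simp add: vector_matrix_mul_assoc W(2))
  also have "\<dots> = (\<Sum>k\<in>UNIV. (w v* B) $ k *\<^sub>R row k W)"
    by (simp add: vec_eq_iff vector_matrix_mult_def row_def mult.commute)
  finally have w': "w = (\<Sum>k\<in>UNIV. (w v* B) $ k *\<^sub>R row k W)" .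
  have eq: "v = (\<lambda>f. \<Sum>k\<in>UNIV. (w v* B) $ k * X k p f)"
    unfolding w W(1) by (subst w') (simp add: fun_eq_iff coord_vector_sum[OF atlas c])
  have "g p v (X k p) = (w v* B) $ k" for k
    by (subst eq) (rule metric_frame_sum)
  then show ?thesis using eq by simp
qed

lemma frame_dual_functions:
  obtains f where "\<And>l. smooth_near A p (f l)" "\<And>k l. X k p (f l) = (if l = k then 1 else 0)"
proof -
  obtain U \<phi> where c: "(U, \<phi>) \<in> A" "p \<in> U" using chart_at[OF atlas] .
  obtain W B :: "real^3^3" where W: "\<And>k. X k p = coord_vector A U \<phi> p (row k W)" "W ** B = mat 1"
    using frame_matrix[OF c] by metis
  have "X k p (\<lambda>x. \<phi> x \<bullet> column l B) = (if l = k then 1 else 0)" for k l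
  proof -
    have "row k W \<bullet> column l B = (W ** B) $ k $ l"
      by (simp add: row_def inner_vec_def column_def matrix_matrix_mult_def)
    then show ?thesis
      by (simp add: W coord_vector_coordinate[OF atlas c] mat_def)
  qed
  then show ?thesis
    by (intro that[of "\<lambda>l x. \<phi> x \<bullet> column l B"] smooth_near_coordinate[OF atlas c])
qed

section \<open>The adjoint action and the structure constants\<close>

lemma mult_function_smooth:
  assumes c: "(U, \<phi>) \<in> A" and e: "(E, \<epsilon>) \<in> A" and W: "open W" "W \<subseteq> U"
    and f: "smooth_on (\<phi> ` W) (f \<circ> inv_into U \<phi>)"
  shows "smooth_on {(x, y). x \<in> \<phi> ` U \<and> y \<in> \<epsilon> ` E \<and> inv_into U \<phi> x \<otimes> inv_into E \<epsilon> y \<in> W}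
     (\<lambda>(x, y). f (inv_into U \<phi> x \<otimes> inv_into E \<epsilon> y))"
    (is "smooth_on ?O _")
proof -
  let ?O' = "{(x, y). x \<in> \<phi> ` U \<and> y \<in> \<epsilon> ` E \<and> inv_into U \<phi> x \<otimes> inv_into E \<epsilon> y \<in> U}"
  let ?m = "\<lambda>(x, y). \<phi> (inv_into U \<phi> x \<otimes> inv_into E \<epsilon> y)"
  have oO: "open ?O" by (rule mult_domain_open[OF c e W(1)])
  have m: "smooth_on ?O ?m"
    by (rule smooth_on_subset[OF mult_domain_open[OF c e chart_open[OF atlas c]] oO _ mult_chart_smooth[OF c e c]])
      (use W(2) in auto)
  have oW: "open (\<phi> ` W)"
    using chart_image_open_Int[OF atlas c W(1)] W(2) by (simp add: Int_absorb1)
  have "smooth_on ?O ((f \<circ> inv_into U \<phi>) \<circ> ?m)"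
    by (rule smooth_on_compose[OF oO oW _ m f]) auto
  moreover have "((f \<circ> inv_into U \<phi>) \<circ> ?m) z = (case z of (x, y) \<Rightarrow> f (inv_into U \<phi> x \<otimes> inv_into E \<epsilon> y))"
    if "z \<in> ?O" for z
    using that W(2) chart_inv[OF atlas c] by auto
  ultimately show ?thesis using smooth_on_cong by blast
qed

text \<open>
  Both derivatives along the curve \<open>t \<mapsto> inv_into E \<epsilon> (\<epsilon> \<one> + t *\<^sub>R w)\<close>, which leaves the identity with
  velocity \<open>X i \<one>\<close>, are read off from \<open>K(x, y) = f(x y)\<close> in charts at \<open>p\<close> and \<open>\<one>\<close>.
  Left invariance identifies \<open>X i q f\<close> with a derivative of \<open>K\<close> in the second argument, and
  \<open>X j p\<close> acts on a right translate of \<open>f\<close> as a derivative in the first argument.  The second claim is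
  the symmetry of the mixed second derivative of \<open>K\<close>.
\<close>

lemma translation_derivatives:
  assumes f: "smooth_near A p f"
    and e: "(E, \<epsilon>) \<in> A" "\<one> \<in> E" and w: "X i \<one> = coord_vector A E \<epsilon> \<one> w"
  shows "((\<lambda>t. f (p \<otimes> inv_into E \<epsilon> (\<epsilon> \<one> + t *\<^sub>R w))) has_real_derivative X i p f) (at 0)" (is ?th1)
    and "((\<lambda>t. X j p (f \<circ> (\<lambda>x. x \<otimes> inv_into E \<epsilon> (\<epsilon> \<one> + t *\<^sub>R w)))) has_real_derivative
       X j p (\<lambda>q. X i q f)) (at 0)" (is ?th2)
proof -
  obtain U \<phi> where c: "(U, \<phi>) \<in> A" "p \<in> U" using chart_at[OF atlas] .
  obtain v where v: "X j p = coord_vector A U \<phi> p v"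
    using frame_tangent tangent_space_eq[OF atlas c] by blast
  obtain W1 where W1: "open W1" "p \<in> W1" "W1 \<subseteq> U" "open (\<phi> ` W1)" "smooth_on (\<phi> ` W1) (f \<circ> inv_into U \<phi>)"
    using smooth_near_chart[OF atlas c(1) f c(2)] .
  obtain W2 where W2: "open W2" "p \<in> W2" "\<And>q. q \<in> W2 \<Longrightarrow> smooth_near A q f"
    using smooth_near_open[OF f] by blast
  define W where "W = W1 \<inter> W2"
  have W: "open W" "p \<in> W" "W \<subseteq> U" "\<And>q. q \<in> W \<Longrightarrow> smooth_near A q f"
    using W1 W2 by (auto simp: W_def)
  have UW: "U \<inter> W = W" using W(3) by auto
  have oW: "open (\<phi> ` W)"
    using chart_image_open_Int[OF atlas c(1) W(1)] unfolding UW .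
  have fW: "smooth_on (\<phi> ` W) (f \<circ> inv_into U \<phi>)"
    by (rule smooth_on_subset[OF W1(4) oW _ W1(5)]) (auto simp: W_def)
  define K where "K = (\<lambda>(x, y). f (inv_into U \<phi> x \<otimes> inv_into E \<epsilon> y))"
  define O' where "O' = {(x, y). x \<in> \<phi> ` U \<and> y \<in> \<epsilon> ` E \<and> inv_into U \<phi> x \<otimes> inv_into E \<epsilon> y \<in> W}"
  have oO: "open O'" unfolding O'_def by (rule mult_domain_open[OF c(1) e(1) W(1)])
  have sK: "smooth_on O' K"
    unfolding O'_def K_def by (rule mult_function_smooth[OF c(1) e(1) W(1,3) fW])
  have dK: "(K has_derivative frechet_derivative K (at z)) (at z)" if "z \<in> O'" for z
    using smooth_on_differentiable[OF oO sK that] frechet_derivative_works by blast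
  define z0 where "z0 = (\<phi> p, \<epsilon> \<one>)"
  have z0: "z0 \<in> O'"
    using c e W by (auto simp: O'_def z0_def chart_inv[OF atlas c(1)] chart_inv[OF atlas e(1)])

  \<comment> \<open>the left translate of \<open>f\<close> by \<open>q\<close> is \<open>K\<close> with the first argument held at \<open>\<phi> q\<close>\<close>
  have left: "X i q f = frechet_derivative K (at (\<phi> q, \<epsilon> \<one>)) (0, w)" if q: "q \<in> W" for q
  proof -
    have z: "(\<phi> q, \<epsilon> \<one>) \<in> O'"
      using q e W(3) by (auto simp: O'_def chart_inv[OF atlas c(1)] chart_inv[OF atlas e(1)])
    have "((\<lambda>y. (\<phi> q, y)) has_derivative (\<lambda>y. (0, y))) (at (\<epsilon> \<one>))"
      by (auto intro!: derivative_eq_intros)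
    from diff_chain_at[OF this dK[OF z]]
    have "((f \<circ> (\<lambda>x. q \<otimes> x) \<circ> inv_into E \<epsilon>) has_derivative
        frechet_derivative K (at (\<phi> q, \<epsilon> \<one>)) \<circ> (\<lambda>y. (0, y))) (at (\<epsilon> \<one>))"
      using chart_inv[OF atlas c(1), of q] q W(3) by (auto simp: K_def o_def)
    moreover have "smooth_near A \<one> (f \<circ> (\<lambda>x. q \<otimes> x))"
      using smooth_near_compose[OF atlas smooth_map_left, of q \<one> f] W(4)[OF q] by simp
    moreover have "X i q f = X i \<one> (f \<circ> (\<lambda>x. q \<otimes> x))"
      using frame_left_translate[of i q \<one> f] by simp
    ultimately show ?thesis
      unfolding w coord_vector_def by (simp add: frechet_derivative_eqI)
  qed

  \<comment> \<open>the right translate of \<open>f\<close> is \<open>K\<close> with the second argument held at \<open>y\<close>\<close>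
  have right: "X j p (f \<circ> (\<lambda>x. x \<otimes> inv_into E \<epsilon> y)) = frechet_derivative K (at (\<phi> p, y)) (v, 0)"
    if y: "(\<phi> p, y) \<in> O'" for y
  proof -
    have "((\<lambda>x. (x, y)) has_derivative (\<lambda>x. (x, 0))) (at (\<phi> p))"
      by (auto intro!: derivative_eq_intros)
    from diff_chain_at[OF this dK[OF y]]
    have "((f \<circ> (\<lambda>x. x \<otimes> inv_into E \<epsilon> y) \<circ> inv_into U \<phi>) has_derivative
        frechet_derivative K (at (\<phi> p, y)) \<circ> (\<lambda>x. (x, 0))) (at (\<phi> p))"
      by (auto simp: K_def o_def)
    moreover have "smooth_near A (p \<otimes> inv_into E \<epsilon> y) f"
      using y W(4) chart_inv[OF atlas c(1) c(2)] by (auto simp: O'_def)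
    then have "smooth_near A p (f \<circ> (\<lambda>x. x \<otimes> inv_into E \<epsilon> y))"
      by (rule smooth_near_compose[OF atlas smooth_map_right])
    ultimately show ?thesis
      unfolding v coord_vector_def by (simp add: frechet_derivative_eqI)
  qed

  have d1: "((\<lambda>t. K (z0 + t *\<^sub>R (0, w))) has_real_derivative
      frechet_derivative K (at (z0 + 0 *\<^sub>R (0, w))) (0, w)) (at 0)"
    by (rule directional_has_real_derivative) (use smooth_on_differentiable[OF oO sK z0] in \<open>simp flip: zero_prod_def\<close>)
  then show ?th1
    using left[OF W(2)] chart_inv[OF atlas c(1) c(2)] by (simp add: K_def z0_def)

  let ?Dv = "\<lambda>z. frechet_derivative K (at z) (v, 0)" and ?Dw = "\<lambda>z. frechet_derivative K (at z) (0, w)"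
  have dDv: "?Dv differentiable (at z0)" and dDw: "?Dw differentiable (at z0)"
    by (rule smooth_on_differentiable[OF oO smooth_on_derivative[OF oO sK] z0])+
  have "X j p (\<lambda>q. X i q f) = frechet_derivative ?Dw (at z0) (v, 0)"
  proof -
    have "((\<lambda>x. (x, \<epsilon> \<one>)) has_derivative (\<lambda>x. (x, 0))) (at (\<phi> p))"
      by (auto intro!: derivative_eq_intros)
    from diff_chain_at[OF this dDw[unfolded frechet_derivative_works z0_def]]
    have "((\<lambda>x. ?Dw (x, \<epsilon> \<one>)) has_derivative (\<lambda>x. frechet_derivative ?Dw (at z0) (x, 0))) (at (\<phi> p))"
      by (simp add: o_def z0_def)
    then have "((\<lambda>q. X i q f) \<circ> inv_into U \<phi> has_derivative (\<lambda>x. frechet_derivative ?Dw (at z0) (x, 0))) (at (\<phi> p))"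
      by (rule has_derivative_transform_within_open[OF _ oW])
         (use W(2,3) left in \<open>auto simp: chart_inv[OF atlas c(1)] subset_iff\<close>)
    then show ?thesis
      unfolding v coord_vector_def using frame_smooth[OF f] by (simp add: frechet_derivative_eqI)
  qed
  also have "\<dots> = frechet_derivative ?Dv (at z0) (0, w)"
    by (rule symmetric_second_derivative[OF oO sK z0])
  finally have eq: "X j p (\<lambda>q. X i q f) = frechet_derivative ?Dv (at z0) (0, w)" .
  have d2: "((\<lambda>t. ?Dv (z0 + t *\<^sub>R (0, w))) has_real_derivative
      frechet_derivative ?Dv (at (z0 + 0 *\<^sub>R (0, w))) (0, w)) (at 0)"
    by (rule directional_has_real_derivative) (use dDv in \<open>simp flip: zero_prod_def\<close>)
  have "open ((\<lambda>t. z0 + t *\<^sub>R (0, w)) -` O')"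
    by (intro open_vimage oO continuous_intros)
  from has_field_derivative_transform_within_open[OF d2 this]
  have "((\<lambda>t. X j p (f \<circ> (\<lambda>x. x \<otimes> inv_into E \<epsilon> (\<epsilon> \<one> + t *\<^sub>R w)))) has_real_derivative
      frechet_derivative ?Dv (at (z0 + 0 *\<^sub>R (0, w))) (0, w)) (at 0)"
    using z0 right by (auto simp: z0_def)
  then show ?th2
    unfolding eq by (simp flip: zero_prod_def)
qed

text \<open>
  The matrix of the adjoint action of \<open>inv h\<close>: right translation by \<open>h\<close> carries the left-invariant
  field \<open>X j\<close> to a left-invariant field, whose coefficients are found at the image \<open>h\<close> of the identity.
\<close>

definition ad_coeff :: "'g \<Rightarrow> 3 \<Rightarrow> 3 \<Rightarrow> real" where
  "ad_coeff h k j = g h (pushforward (\<lambda>x. x \<otimes> h) (X j \<one>)) (X k h)"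

lemma right_translate_tangent:
  assumes "v \<in> tangent_space A p" shows "pushforward (\<lambda>x. x \<otimes> h) v \<in> tangent_space A (p \<otimes> h)"
  by (rule pushforward_tangent_space[OF atlas smooth_map_right smooth_map_right[of "inv h"] _ _ assms])
     (simp_all add: m_assoc)

text \<open>
  Left and right translations commute, so the expansion at \<open>h\<close> is transported to \<open>p \<otimes> h\<close> with the same
  coefficients.
\<close>

lemma right_translate_frame:
  "X j p (f \<circ> (\<lambda>x. x \<otimes> h)) = (\<Sum>k\<in>UNIV. ad_coeff h k j * X k (p \<otimes> h) f)"
proof -
  have *: "pushforward (\<lambda>x. x \<otimes> h) (X j \<one>) \<in> tangent_space A h"
    using right_translate_tangent[OF frame_tangent[where i=j and p="\<one>"], of h] by simp
  have "X j p (f \<circ> (\<lambda>x. x \<otimes> h)) = X j \<one> ((f \<circ> (\<lambda>x. x \<otimes> h)) \<circ> (\<lambda>x. p \<otimes> x))"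
    using frame_left_translate[of j p \<one>] by simp
  also have "\<dots> = pushforward (\<lambda>x. x \<otimes> h) (X j \<one>) (f \<circ> (\<lambda>x. p \<otimes> x))"
    by (simp add: pushforward_def o_def m_assoc)
  also have "\<dots> = (\<Sum>k\<in>UNIV. ad_coeff h k j * X k h (f \<circ> (\<lambda>x. p \<otimes> x)))"
    by (subst frame_expansion[OF *]) (simp add: ad_coeff_def)
  also have "\<dots> = (\<Sum>k\<in>UNIV. ad_coeff h k j * X k (p \<otimes> h) f)"
    by (simp add: frame_left_translate)
  finally show ?thesis .
qed

lemma ad_coeff_orthogonal:
  "(\<Sum>k\<in>UNIV. ad_coeff h k i * ad_coeff h k j) = (if i = j then 1 else 0)"
proof -
  let ?R = "\<lambda>i. pushforward (\<lambda>x. x \<otimes> h) (X i \<one>)"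
  have R: "?R i \<in> tangent_space A h" for i
    using right_translate_tangent[OF frame_tangent[where i=i and p="\<one>"], of h] by simp
  have "g h (?R i) (?R j) = g \<one> (X i \<one>) (X j \<one>)"
    using biinv frame_tangent unfolding bi_invariant_def by (metis UNIV_I carrier_G l_one)
  then have "(if i = j then 1 else 0) = g h (?R i) (?R j)"
    by (simp add: frame_orthonormal)
  also have "\<dots> = (\<Sum>k\<in>UNIV. ad_coeff h k i * g h (X k h) (?R j))"
    by (subst frame_expansion[OF R[of i]]) (simp add: metric_sum frame_tangent R ad_coeff_def)
  also have "\<dots> = (\<Sum>k\<in>UNIV. ad_coeff h k i * ad_coeff h k j)"
    using metric_sym[OF frame_tangent R] by (simp add: ad_coeff_def)
  finally show ?thesis by simp
qed

lemma ad_coeff_bounded: "\<bar>ad_coeff h k j\<bar> \<le> 1"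
proof -
  have "(ad_coeff h k j)\<^sup>2 \<le> (\<Sum>k\<in>UNIV. (ad_coeff h k j)\<^sup>2)"
    by (rule member_le_sum) auto
  also have "\<dots> = 1" using ad_coeff_orthogonal[of h j j] by (simp add: power2_eq_square)
  finally show ?thesis by (simp add: abs_square_le_1)
qed

lemma ad_coeff_one: "ad_coeff \<one> k j = (if j = k then 1 else 0)"
proof -
  have "pushforward (\<lambda>x. x \<otimes> \<one>) (X j \<one>) = X j \<one>" by (simp add: pushforward_def o_def)
  then show ?thesis by (simp add: ad_coeff_def frame_orthonormal)
qed

text \<open>
  The coefficients \<open>d\<close> are the derivatives at the identity, in the direction \<open>X i\<close>, of the orthogonal
  matrices \<^const>\<open>ad_coeff\<close>.  They exist because dual functions turn \<open>right_translate_frame\<close> at the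
  identity into a linear system for the matrix entries.  Skewness comes from orthogonality, and the
  bracket from differentiating \<open>right_translate_frame\<close> for arbitrary \<open>p\<close> and \<open>f\<close>.
\<close>

lemma frame_bracket_fixed:
  "\<exists>d. (\<forall>j k. d j k = - d k j) \<and>
     (\<forall>j p f. smooth_near A p f \<longrightarrow>
        X j p (\<lambda>q. X i q f) - X i p (\<lambda>q. X j q f) = (\<Sum>k\<in>UNIV. d j k * X k p f))"
proof -
  obtain E \<epsilon> where e: "(E, \<epsilon>) \<in> A" "\<one> \<in> E" using chart_at[OF atlas] .
  obtain w where w: "X i \<one> = coord_vector A E \<epsilon> \<one> w"
    using frame_tangent tangent_space_eq[OF atlas e] by blast
  define h where "h t = inv_into E \<epsilon> (\<epsilon> \<one> + t *\<^sub>R w)" for t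
  have h0: "h 0 = \<one>" using chart_inv[OF atlas e] by (simp add: h_def)
  note tr = translation_derivatives[OF _ e w, folded h_def]
  obtain F where F: "\<And>l. smooth_near A \<one> (F l)" "\<And>k l. X k \<one> (F l) = (if l = k then 1 else 0)"
    using frame_dual_functions[of \<one>] by metis
  define d where
    "d j k = X j \<one> (\<lambda>q. X i q (F k)) - (\<Sum>m\<in>UNIV. X i \<one> (\<lambda>q. X m q (F k)) * ad_coeff (h 0) m j)" for j k
  \<comment> \<open>unknowns \<open>ad_coeff (h t) k j\<close>, for fixed \<open>j\<close>, in the system obtained from the dual functions \<open>F l\<close>\<close>
  have d: "((\<lambda>t. ad_coeff (h t) k j) has_real_derivative d j k) (at 0)" for j k
    unfolding d_def
  proof (rule derivative_of_linear_system_solution[where L = "\<lambda>l t. X j \<one> (F l \<circ> (\<lambda>x. x \<otimes> h t))"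
          and M = "\<lambda>l m t. X m (h t) (F l)"])
      show "X j \<one> (F l \<circ> (\<lambda>x. x \<otimes> h t)) = (\<Sum>k\<in>UNIV. X k (h t) (F l) * ad_coeff (h t) k j)" for l t
        by (simp add: right_translate_frame mult.commute)
      show "X m (h 0) (F l) = (if l = m then 1 else 0)" for l m by (simp add: h0 F)
      show "\<bar>ad_coeff (h t) k j\<bar> \<le> 1" for k t by (rule ad_coeff_bounded)
      show "((\<lambda>t. X j \<one> (F l \<circ> (\<lambda>x. x \<otimes> h t))) has_real_derivative X j \<one> (\<lambda>q. X i q (F l))) (at 0)" for l
        by (rule tr(2)[OF F(1)])
      show "((\<lambda>t. X m (h t) (F l)) has_real_derivative X i \<one> (\<lambda>q. X m q (F l))) (at 0)" for l m
        using tr(1)[OF frame_smooth[OF F(1)[of l], of m]] by simp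
  qed
  have "d j k = - d k j" for j k
  proof -
    have "((\<lambda>t. \<Sum>m\<in>UNIV. ad_coeff (h t) m j * ad_coeff (h t) m k) has_real_derivative
        (\<Sum>m\<in>UNIV. d j m * ad_coeff (h 0) m k + d k m * ad_coeff (h 0) m j)) (at 0)"
      by (intro DERIV_sum DERIV_mult d)
    moreover have "(\<Sum>m\<in>UNIV. d j m * ad_coeff (h 0) m k + d k m * ad_coeff (h 0) m j) = d j k + d k j"
      by (simp add: h0 ad_coeff_one sum.distrib if_distrib[of "\<lambda>x. _ * x"] cong: if_cong)
    ultimately have "((\<lambda>t. if j = k then 1 else 0) has_real_derivative d j k + d k j) (at 0)"
      by (simp add: ad_coeff_orthogonal)
    then have "d j k + d k j = 0" by (rule DERIV_unique) simp
    then show ?thesis by simp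
  qed
  moreover have "X j p (\<lambda>q. X i q f) - X i p (\<lambda>q. X j q f) = (\<Sum>k\<in>UNIV. d j k * X k p f)"
    if f: "smooth_near A p f" for j p f
  proof -
    have "((\<lambda>t. \<Sum>k\<in>UNIV. ad_coeff (h t) k j * X k (p \<otimes> h t) f) has_real_derivative
       (\<Sum>k\<in>UNIV. d j k * X k (p \<otimes> h 0) f + X i p (\<lambda>q. X k q f) * ad_coeff (h 0) k j)) (at 0)"
      by (intro DERIV_sum DERIV_mult d tr(1)[OF frame_smooth[OF f]])
    then have "((\<lambda>t. X j p (f \<circ> (\<lambda>x. x \<otimes> h t))) has_real_derivative
       (\<Sum>k\<in>UNIV. d j k * X k (p \<otimes> h 0) f + X i p (\<lambda>q. X k q f) * ad_coeff (h 0) k j)) (at 0)"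
      by (simp add: right_translate_frame)
    from DERIV_unique[OF this tr(2)[OF f]]
    have "X j p (\<lambda>q. X i q f) = (\<Sum>k\<in>UNIV. d j k * X k p f) + X i p (\<lambda>q. X j q f)"
      by (simp add: h0 ad_coeff_one sum.distrib if_distrib[of "\<lambda>x. _ * x"] cong: if_cong)
    then show ?thesis by simp
  qed
  ultimately show ?thesis by blast
qed

text \<open>
  Skewness in the first two indices is that of the bracket; skewness in the first and third is the
  invariance of the metric from \<open>frame_bracket_fixed\<close>.  Together they generate total skewness.
\<close>

lemma structure_constants:
  obtains s where "\<And>i j k. s i j k = - s j i k" "\<And>i j k. s i j k = - s k j i"
    "\<And>i j p. vf_bracket A (X i) (X j) p = (\<lambda>f. \<Sum>k\<in>UNIV. s i j k * X k p f)"
proof -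
  from choice[OF allI[OF frame_bracket_fixed]]
  obtain d where d': "\<forall>i. (\<forall>j k. d i j k = - d i k j) \<and> (\<forall>j p f. smooth_near A p f \<longrightarrow>
        X j p (\<lambda>q. X i q f) - X i p (\<lambda>q. X j q f) = (\<Sum>k\<in>UNIV. d i j k * X k p f))" ..
  have d: "d i j k = - d i k j" "smooth_near A p f \<Longrightarrow>
        X j p (\<lambda>q. X i q f) - X i p (\<lambda>q. X j q f) = (\<Sum>k\<in>UNIV. d i j k * X k p f)" for i j k p f
    using d' by blast+
  define s where "s i j k = d j i k" for i j k
  have br: "vf_bracket A (X i) (X j) p = (\<lambda>f. \<Sum>k\<in>UNIV. s i j k * X k p f)" for i j p
  proof
    fix f
    show "vf_bracket A (X i) (X j) p f = (\<Sum>k\<in>UNIV. s i j k * X k p f)"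
    proof (cases "smooth_near A p f")
      case True
      then show ?thesis using d(2)[of p f i j] by (simp add: vf_bracket_def s_def)
    next
      case False
      then show ?thesis
        by (simp add: vf_bracket_def tangent_vector_not_smooth[OF atlas frame_tangent])
    qed
  qed
  have "s i j k = - s j i k" for i j k
  proof -
    have "(\<lambda>f. \<Sum>k\<in>UNIV. s i j k * X k \<one> f) = (\<lambda>f. \<Sum>k\<in>UNIV. (- s j i k) * X k \<one> f)"
    proof
      fix f
      have "vf_bracket A (X i) (X j) \<one> f = - vf_bracket A (X j) (X i) \<one> f"
        by (simp add: vf_bracket_def)
      then show "(\<Sum>k\<in>UNIV. s i j k * X k \<one> f) = (\<Sum>k\<in>UNIV. (- s j i k) * X k \<one> f)"
        by (simp add: br sum_negf)
    qed
    then show ?thesis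
      using metric_frame_sum[of \<one> "s i j" k] metric_frame_sum[of \<one> "\<lambda>k. - s j i k" k] by simp
  qed
  moreover have "s i j k = - s k j i" for i j k
    using d(1)[of j i k] by (simp add: s_def)
  ultimately show ?thesis using that br by blast
qed

text \<open>
  The coefficients are skew in the last two indices, since the metric is constant on the frame, and
  their skew part in the first two is half the bracket.  With a totally skew bracket the difference
  from \<open>s i j k / 2\<close> is symmetric in the first two and skew in the last two indices, hence zero.
\<close>

lemma connection_coefficients:
  assumes s: "\<And>i j k. s i j k = - s j i k" "\<And>i j k. s i j k = - s k j i"
    "\<And>i j p. vf_bracket A (X i) (X j) p = (\<lambda>f. \<Sum>k\<in>UNIV. s i j k * X k p f)"
  shows "g p (nab (X i) (X j) p) (X k p) = s i j k / 2"
proof -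
  define \<Gamma> where "\<Gamma> i j k = g p (nab (X i) (X j) p) (X k p)" for i j k
  have nab: "nab (X i) (X j) p \<in> tangent_space A p" for i j
    using lc frame_vector_field by (auto simp: levi_civita_def affine_connection_def vector_fields_def)
  have compat: "\<Gamma> i j k = - \<Gamma> i k j" for i j k
  proof -
    have "X i p (\<lambda>q. g q (X j q) (X k q)) = g p (nab (X i) (X j) p) (X k p) + g p (X j p) (nab (X i) (X k) p)"
      using lc frame_vector_field by (simp add: levi_civita_def)
    moreover have "X i p (\<lambda>q. g q (X j q) (X k q)) = 0"
      by (simp add: frame_orthonormal tangent_vector_const[OF atlas frame_tangent])
    ultimately show ?thesis
      using metric_sym[OF frame_tangent nab, of j i k] by (simp add: \<Gamma>_def)
  qed
  have torsion: "\<Gamma> i j k - \<Gamma> j i k = s i j k" for i j k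
  proof -
    have "(\<lambda>p f. nab (X i) (X j) p f - nab (X j) (X i) p f) = vf_bracket A (X i) (X j)"
      using lc frame_vector_field by (simp add: levi_civita_def)
    then have "(\<lambda>f. 1 * nab (X i) (X j) p f + (-1) * nab (X j) (X i) p f) = (\<lambda>f. \<Sum>k\<in>UNIV. s i j k * X k p f)"
      unfolding s(3)[symmetric] by (simp add: fun_eq_iff)
    then have "g p (\<lambda>f. 1 * nab (X i) (X j) p f + (-1) * nab (X j) (X i) p f) (X k p) = s i j k"
      by (simp add: metric_frame_sum)
    then show ?thesis
      unfolding metric_linear[OF nab nab frame_tangent] by (simp add: \<Gamma>_def)
  qed
  show ?thesis
    using compat[of i j k] compat[of j k i] compat[of k i j]
      torsion[of i j k] torsion[of j k i] torsion[of k i j]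
      s(1)[of i j k] s(1)[of j k i] s(1)[of k i j] s(2)[of i j k] s(2)[of j k i] s(2)[of k i j]
    unfolding \<Gamma>_def[symmetric] by linarith
qed

text \<open>
  In three dimensions the alternating trilinear forms are the multiples of the determinant.
\<close>

lemma cross_product_of_alternating:
  fixes s :: "3 \<Rightarrow> 3 \<Rightarrow> 3 \<Rightarrow> real"
  assumes s: "\<And>i j k. s i j k = - s j i k" "\<And>i j k. s i j k = - s k j i"
  shows "(\<chi> k. \<Sum>i\<in>UNIV. \<Sum>j\<in>UNIV. u $ i * v $ j * s i j k) = s 1 2 3 *\<^sub>R cross3 u v"
proof -
  have z: "s i i k = 0" "s i k i = 0" "s k i i = 0" for i k
    using s(1)[of i i k] s(2)[of i k i] s(1)[of k i i] s(2)[of i i k] by auto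
  have e: "s 2 1 3 = - s 1 2 3" "s 2 3 1 = s 1 2 3" "s 3 2 1 = - s 1 2 3" "s 3 1 2 = s 1 2 3" "s 1 3 2 = - s 1 2 3"
    using s(1)[of 2 1 3] s(2)[of 3 2 1] s(1)[of 2 3 1] s(2)[of 2 1 3] s(1)[of 3 1 2] s(2)[of 3 1 2] by auto
  show ?thesis
    by (simp add: vec_eq_iff forall_3 sum_3 cross3_def z e algebra_simps)
qed

lemma bracket_and_connection_cross:
  obtains b where "\<And>u v. frame_bracket G A g X u v = (2 * b) *\<^sub>R cross3 u v"
    "\<And>I c T U t. cov_deriv g nab X I c T U t = vector_derivative U (at t within I) + b *\<^sub>R cross3 (T t) (U t)"
proof -
  obtain s where s: "\<And>i j k. s i j k = - s j i k" "\<And>i j k. s i j k = - s k j i"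
    "\<And>i j p. vf_bracket A (X i) (X j) p = (\<lambda>f. \<Sum>k\<in>UNIV. s i j k * X k p f)"
    using structure_constants by blast
  have "frame_bracket G A g X u v = (2 * (s 1 2 3 / 2)) *\<^sub>R cross3 u v" for u v
    unfolding frame_bracket_def s(3) metric_frame_sum by (simp add: cross_product_of_alternating[OF s(1,2)])
  moreover have "cov_deriv g nab X I c T U t = vector_derivative U (at t within I) + (s 1 2 3 / 2) *\<^sub>R cross3 (T t) (U t)" for I c T U t
  proof -
    have half: "s i j k / 2 = - (s j i k / 2)" "s i j k / 2 = - (s k j i / 2)" for i j k
      using s(1)[of i j k] s(2)[of i j k] by simp_all
    have "(\<chi> k. \<Sum>i\<in>UNIV. \<Sum>j\<in>UNIV. T t $ i * U t $ j * (s i j k / 2)) = (s 1 2 3 / 2) *\<^sub>R cross3 (T t) (U t)"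
      by (rule cross_product_of_alternating[where s = "\<lambda>i j k. s i j k / 2", OF half])
    then show ?thesis
      unfolding cov_deriv_def connection_coefficients[OF s] by simp
  qed
  ultimately show ?thesis using that by blast
qed

end

section \<open>Frenet frames in Euclidean three-space\<close>

lemma interval_at_within_nontrivial:
  fixes I :: "real set"
  assumes "is_interval I" "interior I \<noteq> {}" "t \<in> I"
  shows "at t within I \<noteq> bot"
proof -
  have "I \<noteq> {x}" for x using assms(2) by auto
  then have "t islimpt I"
    using connected_imp_perfect assms(1,3) is_interval_connected by blast
  then show ?thesis by (simp add: trivial_limit_within)
qed

text \<open>
  At points of a nondegenerate interval, end points included, the derivative within the interval is
  unique, so it agrees with the one chosen in the definition of smoothness.
\<close>

lemma smooth_on_interval_derivative:
  fixes f :: "real \<Rightarrow> 'a::euclidean_space"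
  assumes I: "is_interval I" "interior I \<noteq> {}" and f: "smooth_on I f"
  shows "(\<lambda>t. vector_derivative f (at t within I)) differentiable_on I"
proof -
  have 2: "Ck_on (Suc (Suc 0)) I f" using f unfolding smooth_on_def by blast
  have "frechet_derivative f (at t within I) 1 = vector_derivative f (at t within I)" if t: "t \<in> I" for t
  proof -
    have d: "f differentiable (at t within I)" using 2 t by (simp add: differentiable_on_def)
    then have "(f has_derivative frechet_derivative f (at t within I)) (at t within I)"
      using frechet_derivative_works by blast
    moreover have "frechet_derivative f (at t within I) = (\<lambda>x. x *\<^sub>R frechet_derivative f (at t within I) 1)"
      by (rule ext) (metis linear_scale linear_frechet_derivative[OF d] mult.right_neutral real_scaleR_def)
    ultimately have "(f has_vector_derivative frechet_derivative f (at t within I) 1) (at t within I)"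
      unfolding has_vector_derivative_def by simp
    then show ?thesis
      using vector_derivative_within interval_at_within_nontrivial[OF I t] by metis
  qed
  moreover have "(\<lambda>t. frechet_derivative f (at t within I) 1) differentiable_on I"
    using 2 by simp
  ultimately show ?thesis
    unfolding differentiable_on_def
    using differentiable_transform_within[OF _ zero_less_one] by (metis (no_types, lifting))
qed

text \<open>
  The vector \<open>w\<close> is parallel to the unit vector \<open>cross3 u v\<close>, and the determinant is their inner
  product, whose sign rules out the opposite direction.
\<close>

lemma cross3_oriented_orthonormal:
  fixes u v w :: "real^3"
  assumes n: "norm u = 1" "norm v = 1" "norm w = 1" and o: "u \<bullet> v = 0" "u \<bullet> w = 0" "v \<bullet> w = 0"
    and pos: "det (vector [u, v, w] :: real^3^3) > 0"
  shows "cross3 u v = w" "cross3 u w = - v" "cross3 v w = u"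
proof -
  have uu: "u \<bullet> u = 1" "v \<bullet> v = 1" "w \<bullet> w = 1" using n by (simp_all add: dot_square_norm)
  let ?c = "cross3 u v"
  have c1: "norm ?c = 1"
    using norm_cross_dot[of u v] n o by (simp add: abs_square_eq_1 power2_eq_1_iff)
  have "cross3 w ?c = 0" using o by (simp add: Lagrange inner_commute)
  then have sq: "(w \<bullet> ?c)\<^sup>2 = 1" using norm_cross_dot[of w ?c] n c1 by simp
  have "w \<bullet> ?c = det (vector [u, v, w] :: real^3^3)"
    using dot_cross_det[of u v w] cross_triple[of u v w] by (simp add: inner_commute)
  then have wc: "w \<bullet> ?c = 1" using sq pos by (simp add: power2_eq_1_iff)
  have "?c \<bullet> ?c = 1" using c1 by (simp add: dot_square_norm)
  moreover have "(?c - w) \<bullet> (?c - w) = ?c \<bullet> ?c - 2 * (w \<bullet> ?c) + w \<bullet> w"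
    by (simp add: inner_diff_left inner_diff_right inner_commute)
  ultimately have "(?c - w) \<bullet> (?c - w) = 0" using wc uu by linarith
  then show c: "?c = w" by simp
  show "cross3 u w = - v" "cross3 v w = u"
    unfolding c[symmetric] using o uu by (simp_all add: Lagrange inner_commute)
qed

text \<open>
  A Frenet frame of Euclidean three-space along \<open>I\<close>, with derivatives within \<open>I\<close>.  The three cross
  products express the orientation in the form in which it is used.
\<close>

definition frenet_frame ::
    "real set \<Rightarrow> (real \<Rightarrow> real^3) \<Rightarrow> (real \<Rightarrow> real^3) \<Rightarrow> (real \<Rightarrow> real^3) \<Rightarrow>
     (real \<Rightarrow> real) \<Rightarrow> (real \<Rightarrow> real) \<Rightarrow> bool" where
  "frenet_frame I T N B \<kappa> \<rho> \<longleftrightarrow>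
     (\<forall>t\<in>I. \<kappa> t > 0 \<and> norm (T t) = 1 \<and> norm (N t) = 1 \<and> norm (B t) = 1 \<and>
        T t \<bullet> N t = 0 \<and> T t \<bullet> B t = 0 \<and> N t \<bullet> B t = 0 \<and>
        cross3 (T t) (N t) = B t \<and> cross3 (T t) (B t) = - N t \<and> cross3 (N t) (B t) = T t \<and>
        (T has_vector_derivative \<kappa> t *\<^sub>R N t) (at t within I) \<and>
        (N has_vector_derivative - \<kappa> t *\<^sub>R T t + \<rho> t *\<^sub>R B t) (at t within I) \<and>
        (B has_vector_derivative - \<rho> t *\<^sub>R N t) (at t within I))"

text \<open>
  The tangent determines \<open>\<kappa> N\<close>, and positivity of \<open>\<kappa>\<close> separates the two factors; \<open>B\<close> is then the cross
  product and \<open>\<rho>\<close> the \<open>B\<close>-component of the derivative of \<open>N\<close>.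
\<close>

lemma frenet_frame_unique:
  assumes I: "is_interval I" "interior I \<noteq> {}"
    and F: "frenet_frame I T N B \<kappa> \<rho>" and F': "frenet_frame I T' N' B' \<kappa>' \<rho>'"
    and T: "\<And>t. t \<in> I \<Longrightarrow> T t = T' t" and t: "t \<in> I"
  shows "N t = N' t" "B t = B' t" "\<kappa> t = \<kappa>' t" "\<rho> t = \<rho>' t"
proof -
  have eq: "N s = N' s \<and> \<kappa> s = \<kappa>' s" if s: "s \<in> I" for s
  proof -
    have "(T has_vector_derivative \<kappa>' s *\<^sub>R N' s) (at s within I)"
      by (rule has_vector_derivative_transform[of s I T T']) (use s T F' in \<open>auto simp: frenet_frame_def\<close>)
    then have e: "\<kappa> s *\<^sub>R N s = \<kappa>' s *\<^sub>R N' s"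
      using vector_derivative_unique_within[OF interval_at_within_nontrivial[OF I s]] F s
      unfolding frenet_frame_def by blast
    have k: "\<kappa> s > 0" "\<kappa>' s > 0" "norm (N s) = 1" "norm (N' s) = 1"
      using F F' s by (auto simp: frenet_frame_def)
    have "\<kappa> s = \<kappa>' s"
      using arg_cong[OF e, of norm] k by simp
    then show ?thesis using e k by simp
  qed
  then show N: "N t = N' t" and k: "\<kappa> t = \<kappa>' t" using t by auto
  show B: "B t = B' t" using F F' t N T[OF t] unfolding frenet_frame_def by metis
  have "(N has_vector_derivative - \<kappa>' t *\<^sub>R T' t + \<rho>' t *\<^sub>R B' t) (at t within I)"
    by (rule has_vector_derivative_transform[of t I N N']) (use t eq F' in \<open>auto simp: frenet_frame_def\<close>)
  then have "- \<kappa> t *\<^sub>R T t + \<rho> t *\<^sub>R B t = - \<kappa>' t *\<^sub>R T' t + \<rho>' t *\<^sub>R B' t"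
    using vector_derivative_unique_within[OF interval_at_within_nontrivial[OF I t]] F t
    unfolding frenet_frame_def by blast
  then have "\<rho> t *\<^sub>R B t = \<rho>' t *\<^sub>R B t" using k T[OF t] B by simp
  moreover have "B t \<noteq> 0" using F t by (force simp: frenet_frame_def)
  ultimately show "\<rho> t = \<rho>' t" by simp
qed

text \<open>
  \<open>(B, - s N, s T)\<close> is a Frenet frame with tangent \<open>B\<close> as soon as \<open>s\<close> is the sign of \<open>\<rho>\<close>, needed for a
  positive curvature \<open>s \<rho>\<close>; it can be differentiated because \<open>s\<close> does not depend on the parameter.
\<close>

lemma frenet_frame_mate:
  assumes I: "is_interval I" "interior I \<noteq> {}"
    and F: "frenet_frame I T N B \<kappa> \<rho>" and F': "frenet_frame I T' N' B' \<kappa>' \<rho>'"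
    and T': "\<And>t. t \<in> I \<Longrightarrow> T' t = B t" and cont: "continuous_on I \<rho>" and nz: "\<And>t. t \<in> I \<Longrightarrow> \<rho> t \<noteq> 0"
  obtains s where "s = 1 \<or> s = - 1" "\<And>t. t \<in> I \<Longrightarrow> \<kappa>' t = s * \<rho> t" "\<And>t. t \<in> I \<Longrightarrow> \<rho>' t = \<kappa> t"
proof -
  have conn: "connected (\<rho> ` I)"
    using connected_continuous_image[OF cont] I(1) is_interval_connected by blast
  have "(\<forall>t\<in>I. \<rho> t > 0) \<or> (\<forall>t\<in>I. \<rho> t < 0)"
  proof (rule ccontr)
    assume "\<not> ?thesis"
    then obtain a b where "a \<in> I" "b \<in> I" "\<rho> a < 0" "\<rho> b > 0" using nz by (metis linorder_neqE_linordered_idom)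
    then have "0 \<in> \<rho> ` I"
      using connectedD_interval[OF conn, of "\<rho> a" "\<rho> b" 0] by simp
    then show False using nz by auto
  qed
  then obtain s where s: "s = 1 \<or> s = - 1" "\<And>t. t \<in> I \<Longrightarrow> s * \<rho> t > 0"
    by (metis mult_minus1 mult_1 neg_0_less_iff_less)
  then have ss: "s * s = 1" by auto
  have "frenet_frame I B (\<lambda>t. - s *\<^sub>R N t) (\<lambda>t. s *\<^sub>R T t) (\<lambda>t. s * \<rho> t) \<kappa>"
    unfolding frenet_frame_def
  proof (intro ballI conjI)
    fix t assume t: "t \<in> I"
    note Ft = F[unfolded frenet_frame_def, rule_format, OF t]
    show "s * \<rho> t > 0" by (rule s(2)[OF t])
    show "norm (B t) = 1" "norm (- s *\<^sub>R N t) = 1" "norm (s *\<^sub>R T t) = 1" using Ft s(1) by auto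
    show "B t \<bullet> (- s *\<^sub>R N t) = 0" "B t \<bullet> (s *\<^sub>R T t) = 0" "(- s *\<^sub>R N t) \<bullet> (s *\<^sub>R T t) = 0"
      using Ft by (auto simp: inner_commute)
    show "cross3 (B t) (- s *\<^sub>R N t) = s *\<^sub>R T t"
      using Ft by (simp add: cross_mult_right cross_skew[of "B t"])
    show "cross3 (B t) (s *\<^sub>R T t) = - (- s *\<^sub>R N t)"
      using Ft by (simp add: cross_mult_right cross_skew[of "B t"])
    show "cross3 (- s *\<^sub>R N t) (s *\<^sub>R T t) = B t"
      using Ft ss by (simp add: cross_mult_right cross_mult_left cross_skew[of "N t" "T t"])
    show "(B has_vector_derivative (s * \<rho> t) *\<^sub>R - s *\<^sub>R N t) (at t within I)"
      using Ft s(1) by auto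
    have "((\<lambda>t. - s *\<^sub>R N t) has_vector_derivative - s *\<^sub>R (- \<kappa> t *\<^sub>R T t + \<rho> t *\<^sub>R B t)) (at t within I)"
      using Ft by (intro bounded_linear.has_vector_derivative[OF bounded_linear_scaleR_right]) auto
    then show "((\<lambda>t. - s *\<^sub>R N t) has_vector_derivative - (s * \<rho> t) *\<^sub>R B t + \<kappa> t *\<^sub>R s *\<^sub>R T t) (at t within I)"
      by (simp add: algebra_simps)
    have "((\<lambda>t. s *\<^sub>R T t) has_vector_derivative s *\<^sub>R \<kappa> t *\<^sub>R N t) (at t within I)"
      using Ft by (intro bounded_linear.has_vector_derivative[OF bounded_linear_scaleR_right]) auto
    then show "((\<lambda>t. s *\<^sub>R T t) has_vector_derivative - \<kappa> t *\<^sub>R - s *\<^sub>R N t) (at t within I)"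
      by (simp add: mult.commute)
  qed
  from frenet_frame_unique[OF I F' this T'] that[OF s(1)] show ?thesis by blast
qed

text \<open>
  Curvature and torsion are the inner products of \<open>T'\<close> with \<open>N\<close> and of \<open>N'\<close> with \<open>B\<close>.
\<close>

lemma frenet_frame_differentiable:
  assumes I: "is_interval I" "interior I \<noteq> {}" and F: "frenet_frame I T N B \<kappa> \<rho>"
    and sm: "smooth_on I T" "smooth_on I N" "smooth_on I B"
  shows "\<kappa> differentiable_on I" "\<rho> differentiable_on I"
proof -
  have d: "N differentiable_on I" "B differentiable_on I"
    using sm(2,3) unfolding smooth_on_def by (metis Ck_on.simps(2))+
  have nn: "N t \<bullet> N t = 1" "B t \<bullet> B t = 1" "T t \<bullet> B t = 0" if "t \<in> I" for t
    using F that by (auto simp: frenet_frame_def dot_square_norm)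
  have vd: "vector_derivative T (at t within I) = \<kappa> t *\<^sub>R N t"
    "vector_derivative N (at t within I) = - \<kappa> t *\<^sub>R T t + \<rho> t *\<^sub>R B t" if t: "t \<in> I" for t
    using F t vector_derivative_within[OF interval_at_within_nontrivial[OF I t]] unfolding frenet_frame_def by blast+
  have k: "vector_derivative T (at t within I) \<bullet> N t = \<kappa> t" if "t \<in> I" for t
    using vd(1)[OF that] nn(1)[OF that] by simp
  have r: "vector_derivative N (at t within I) \<bullet> B t = \<rho> t" if "t \<in> I" for t
    using vd(2)[OF that] nn[OF that] by (simp add: inner_add_left inner_diff_left)
  have "(\<lambda>t. vector_derivative T (at t within I) \<bullet> N t) differentiable_on I"
    using smooth_on_interval_derivative[OF I sm(1)] d(1) unfolding differentiable_on_def by (auto intro: differentiable_inner)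
  then show "\<kappa> differentiable_on I"
    unfolding differentiable_on_def using k differentiable_transform_within[OF _ zero_less_one] by (metis (no_types, lifting))
  have "(\<lambda>t. vector_derivative N (at t within I) \<bullet> B t) differentiable_on I"
    using smooth_on_interval_derivative[OF I sm(2)] d(2) unfolding differentiable_on_def by (auto intro: differentiable_inner)
  then show "\<rho> differentiable_on I"
    unfolding differentiable_on_def using r differentiable_transform_within[OF _ zero_less_one] by (metis (no_types, lifting))
qed

section \<open>The slant helix quotient\<close>

text \<open>
  The function \<open>1 / \<sigma>\<close> of a curve with harmonic curvature \<open>\<rho> / \<kappa>\<close>.
\<close>

definition slant_quotient :: "real set \<Rightarrow> (real \<Rightarrow> real) \<Rightarrow> (real \<Rightarrow> real) \<Rightarrow> real \<Rightarrow> real" where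
  "slant_quotient I \<kappa> \<rho> t = vector_derivative (\<lambda>t. \<rho> t / \<kappa> t) (at t within I) /
     (\<kappa> t * ((\<rho> t / \<kappa> t)\<^sup>2 + 1) powr (3/2))"

lemma slant_quotient_cong:
  assumes "\<And>t. t \<in> I \<Longrightarrow> \<kappa> t = \<kappa>' t" "\<And>t. t \<in> I \<Longrightarrow> \<rho> t = \<rho>' t" "t \<in> I"
  shows "slant_quotient I \<kappa> \<rho> t = slant_quotient I \<kappa>' \<rho>' t"
proof -
  have "vector_derivative (\<lambda>t. \<rho> t / \<kappa> t) (at t within I) = vector_derivative (\<lambda>t. \<rho>' t / \<kappa>' t) (at t within I)"
    by (rule vector_derivative_cong_eq) (use assms in auto)
  then show ?thesis using assms by (simp add: slant_quotient_def)
qed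

lemma powr_three_halves_inverse:
  fixes h :: real
  assumes "h > 0"
  shows "((1 / h)\<^sup>2 + 1) powr (3/2) = (h\<^sup>2 + 1) powr (3/2) / h ^ 3"
proof -
  have "(1 / h)\<^sup>2 + 1 = (h\<^sup>2 + 1) / h\<^sup>2" using assms by (simp add: field_simps)
  moreover have "(h\<^sup>2) powr (3/2) = h ^ 3"
  proof -
    have "h\<^sup>2 = h powr 2" using assms by simp
    then have "(h\<^sup>2) powr (3/2) = h powr (2 * (3/2))" by (simp only: powr_powr)
    also have "\<dots> = h powr (real 3)" by simp
    also have "\<dots> = h ^ 3" using assms by (simp only: powr_realpow)
    finally show ?thesis .
  qed
  ultimately show ?thesis by (simp add: powr_divide)
qed

text \<open>
  Passing to the mate replaces \<open>H = \<rho> / \<kappa>\<close> by \<open>s / H\<close>, with derivative \<open>- s H' / H\<^sup>2\<close>, and \<open>\<kappa>\<close> by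
  \<open>s \<rho> = \<kappa> \<bar>H\<bar>\<close>.  The powers of \<open>\<bar>H\<bar>\<close> cancel: three from the factor with exponent \<open>3/2\<close>, two from
  the derivative and one from the curvature.
\<close>

lemma slant_quotient_mate:
  assumes nb: "at t within I \<noteq> bot"
    and d: "\<kappa> differentiable (at t within I)" "\<rho> differentiable (at t within I)"
    and pos: "\<kappa> t > 0" "s * \<rho> t > 0" and s: "s = 1 \<or> s = - 1"
  shows "slant_quotient I (\<lambda>t. s * \<rho> t) \<kappa> t = - s * slant_quotient I \<kappa> \<rho> t"
proof -
  obtain k' r' where k': "(\<kappa> has_real_derivative k') (at t within I)" and r': "(\<rho> has_real_derivative r') (at t within I)"
    using d unfolding real_differentiable_def by blast
  have nz: "\<rho> t \<noteq> 0" "\<kappa> t \<noteq> 0" "s \<noteq> 0" "s * s = 1" using pos s by auto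
  have 1: "((\<lambda>t. \<rho> t / \<kappa> t) has_real_derivative (r' * \<kappa> t - \<rho> t * k') / (\<kappa> t * \<kappa> t)) (at t within I)"
    using DERIV_divide[OF r' k'] nz by simp
  have 2: "((\<lambda>t. \<kappa> t / (s * \<rho> t)) has_real_derivative
      (k' * (s * \<rho> t) - \<kappa> t * (s * r')) / ((s * \<rho> t) * (s * \<rho> t))) (at t within I)"
    using DERIV_divide[OF k' DERIV_cmult[OF r', of s]] nz by simp
  have v1: "vector_derivative (\<lambda>t. \<rho> t / \<kappa> t) (at t within I) = (r' * \<kappa> t - \<rho> t * k') / (\<kappa> t * \<kappa> t)"
    using vector_derivative_within[OF nb] 1 has_real_derivative_iff_has_vector_derivative by blast
  have v2: "vector_derivative (\<lambda>t. \<kappa> t / (s * \<rho> t)) (at t within I) =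
      (k' * (s * \<rho> t) - \<kappa> t * (s * r')) / ((s * \<rho> t) * (s * \<rho> t))"
    using vector_derivative_within[OF nb] 2 has_real_derivative_iff_has_vector_derivative by blast
  \<comment> \<open>the absolute value of the harmonic curvature\<close>
  define h where "h = s * \<rho> t / \<kappa> t"
  have h: "h > 0" using pos by (simp add: h_def)
  have e1: "(\<rho> t / \<kappa> t)\<^sup>2 + 1 = h\<^sup>2 + 1" using s by (auto simp: h_def power2_eq_square)
  have e2: "\<kappa> t / (s * \<rho> t) = 1 / h" by (simp add: h_def)
  define P where "P = (h\<^sup>2 + 1) powr (3/2)"
  have P: "P \<noteq> 0" by (simp add: P_def) (smt (verit) zero_le_power2)
  have "slant_quotient I (\<lambda>t. s * \<rho> t) \<kappa> t =
     (k' * (s * \<rho> t) - \<kappa> t * (s * r')) / ((s * \<rho> t) * (s * \<rho> t)) / ((s * \<rho> t) * (P / h ^ 3))"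
    unfolding slant_quotient_def v2 e2 powr_three_halves_inverse[OF h] P_def by simp
  also have "\<dots> = - s * ((r' * \<kappa> t - \<rho> t * k') / (\<kappa> t * \<kappa> t) / (\<kappa> t * P))"
    using s nz P by (auto simp: h_def field_simps power3_eq_cube)
  also have "\<dots> = - s * slant_quotient I \<kappa> \<rho> t"
    unfolding slant_quotient_def v1 e1 P_def by simp
  finally show ?thesis .
qed

section \<open>Slant helices and conjugate mates\<close>

context bi_invariant_lie_group
begin

lemma frame_coefficients_unique:
  assumes "(\<lambda>f. \<Sum>i\<in>UNIV. a $ i * X i p f) = (\<lambda>f. \<Sum>i\<in>UNIV. b $ i * X i p f)"
  shows "a = b"
proof -
  have "a $ k = b $ k" for k
    using metric_frame_sum[of p "\<lambda>i. a $ i" k, unfolded assms metric_frame_sum] by simp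
  then show ?thesis by (simp add: vec_eq_iff)
qed

text \<open>
  The constant \<open>b\<close> depends on the group alone, so it is the same for both curves.  The terms
  \<open>b (T \<times> N) = b B\<close> and \<open>b (T \<times> B) = - b N\<close> of the connection lower the torsion by \<open>b\<close>, and
  \<open>b (T \<times> T)\<close> vanishes.
\<close>

lemma apparatus_frenet_frame:
  obtains b where
    "\<And>I c T N B \<kappa> \<tau> t. frenet_apparatus A g nab X I c T N B \<kappa> \<tau> \<Longrightarrow> t \<in> I \<Longrightarrow> lie_torsion G A g X T N B t = b"
    "\<And>I c T N B \<kappa> \<tau>. frenet_apparatus A g nab X I c T N B \<kappa> \<tau> \<Longrightarrow> frenet_frame I T N B \<kappa> (\<lambda>t. \<tau> t - b)"
proof -
  obtain b where b: "\<And>u v. frame_bracket G A g X u v = (2 * b) *\<^sub>R cross3 u v"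
    "\<And>I c T U t. cov_deriv g nab X I c T U t = vector_derivative U (at t within I) + b *\<^sub>R cross3 (T t) (U t)"
    using bracket_and_connection_cross by blast
  have cross: "cross3 (T t) (N t) = B t \<and> cross3 (T t) (B t) = - N t \<and> cross3 (N t) (B t) = T t"
    if "frenet_apparatus A g nab X I c T N B \<kappa> \<tau>" "t \<in> I" for I c T N B \<kappa> \<tau> t
    using cross3_oriented_orthonormal[of "T t" "N t" "B t"] that unfolding frenet_apparatus_def by blast
  have "lie_torsion G A g X T N B t = b"
    if a: "frenet_apparatus A g nab X I c T N B \<kappa> \<tau>" "t \<in> I" for I c T N B \<kappa> \<tau> t
  proof -
    have "norm (B t) = 1" using a by (simp add: frenet_apparatus_def)
    then show ?thesis
      using cross[OF a] by (simp add: lie_torsion_def b(1) dot_square_norm)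
  qed
  moreover have "frenet_frame I T N B \<kappa> (\<lambda>t. \<tau> t - b)"
    if a: "frenet_apparatus A g nab X I c T N B \<kappa> \<tau>" for I c T N B \<kappa> \<tau>
    unfolding frenet_frame_def
  proof
    fix t assume t: "t \<in> I"
    have sm: "smooth_on I T" "smooth_on I N" "smooth_on I B" using a by (auto simp: frenet_apparatus_def)
    have vd: "(U has_vector_derivative vector_derivative U (at t within I)) (at t within I)"
      if "smooth_on I U" for U :: "real \<Rightarrow> real^3"
    proof -
      have "Ck_on (Suc 0) I U" using that unfolding smooth_on_def by blast
      then show ?thesis using t by (simp add: differentiable_on_def vector_derivative_works)
    qed
    have at: "\<kappa> t > 0" "norm (T t) = 1" "norm (N t) = 1" "norm (B t) = 1"
        "T t \<bullet> N t = 0" "T t \<bullet> B t = 0" "N t \<bullet> B t = 0"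
      and cd: "cov_deriv g nab X I c T T t = \<kappa> t *\<^sub>R N t"
        "cov_deriv g nab X I c T N t = - \<kappa> t *\<^sub>R T t + \<tau> t *\<^sub>R B t"
        "cov_deriv g nab X I c T B t = - \<tau> t *\<^sub>R N t"
      using a t unfolding frenet_apparatus_def by blast+
    have "vector_derivative T (at t within I) = \<kappa> t *\<^sub>R N t"
      "vector_derivative N (at t within I) = - \<kappa> t *\<^sub>R T t + (\<tau> t - b) *\<^sub>R B t"
      "vector_derivative B (at t within I) = - (\<tau> t - b) *\<^sub>R N t"
      using cd cross[OF a t] unfolding b(2) by (simp_all add: algebra_simps)
    then show "\<kappa> t > 0 \<and> norm (T t) = 1 \<and> norm (N t) = 1 \<and> norm (B t) = 1 \<and>
        T t \<bullet> N t = 0 \<and> T t \<bullet> B t = 0 \<and> N t \<bullet> B t = 0 \<and>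
        cross3 (T t) (N t) = B t \<and> cross3 (T t) (B t) = - N t \<and> cross3 (N t) (B t) = T t \<and>
        (T has_vector_derivative \<kappa> t *\<^sub>R N t) (at t within I) \<and>
        (N has_vector_derivative - \<kappa> t *\<^sub>R T t + (\<tau> t - b) *\<^sub>R B t) (at t within I) \<and>
        (B has_vector_derivative - (\<tau> t - b) *\<^sub>R N t) (at t within I)"
      using at cross[OF a t] vd[OF sm(1)] vd[OF sm(2)] vd[OF sm(3)] by simp
  qed
  ultimately show ?thesis using that by blast
qed

lemma apparatus_tangent_unique:
  assumes "frenet_apparatus A g nab X I c T N B \<kappa> \<tau>" "frenet_apparatus A g nab X I c T' N' B' \<kappa>' \<tau>'" "t \<in> I"
  shows "T t = T' t"
  using assms by (intro frame_coefficients_unique[of _ "c t"]) (simp add: frenet_apparatus_def)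

end

theorem corollary6p2:
  fixes G :: "'g::{t2_space,second_countable_topology} monoid"
    and A :: "'g chart set"
    and g :: "'g metric"
    and nab :: "'g vfield \<Rightarrow> 'g vfield \<Rightarrow> 'g vfield"
    and X :: "3 \<Rightarrow> 'g vfield"
    and I :: "real set"
    and \<gamma> \<gamma>' :: "real \<Rightarrow> 'g"
    and T N B :: "real \<Rightarrow> real^3"
    and \<kappa> \<tau> :: "real \<Rightarrow> real"
  assumes "lie_group G A"
    and "riemannian_metric A g"
    and "bi_invariant G A g"
    and "levi_civita A g nab"
    and "orthonormal_basis G A g X"
    and "is_interval I" and "interior I \<noteq> {}"
    and "frenet_apparatus A g nab X I \<gamma> T N B \<kappa> \<tau>"
    and "\<forall>t\<in>I. \<tau> t \<noteq> 0"
    and "\<forall>t\<in>I. \<tau> t - lie_torsion G A g X T N B t \<noteq> 0"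
    and "conjugate_mate A g nab X I \<gamma> \<gamma>'"
  shows "slant_helix G A g nab X I \<gamma> \<longleftrightarrow> slant_helix G A g nab X I \<gamma>'"
proof -
  interpret bi_invariant_lie_group G A g nab X
    by unfold_locales (fact assms)+
  note I = assms(6,7)
  note app = assms(8)
  obtain b where b:
    "\<And>I c T N B \<kappa> \<tau> t. frenet_apparatus A g nab X I c T N B \<kappa> \<tau> \<Longrightarrow> t \<in> I \<Longrightarrow> lie_torsion G A g X T N B t = b"
    "\<And>I c T N B \<kappa> \<tau>. frenet_apparatus A g nab X I c T N B \<kappa> \<tau> \<Longrightarrow> frenet_frame I T N B \<kappa> (\<lambda>t. \<tau> t - b)"
    using apparatus_frenet_frame by blast
  \<comment> \<open>By uniqueness of the apparatus, the existential quantifier over it can be dropped.\<close>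
  have slant: "slant_helix G A g nab X I c \<longleftrightarrow> (\<exists>C. \<forall>t\<in>I. slant_quotient I k (\<lambda>t. r t - b) t = C)"
    if a: "frenet_apparatus A g nab X I c U V W k r" for c U V W k r
  proof -
    have quot: "(let H = harmonic_curvature G A g X U' V' W' k' r' in
         \<exists>C. \<forall>t\<in>I. vector_derivative H (at t within I) / (k' t * ((H t)\<^sup>2 + 1) powr (3/2)) = C)
       \<longleftrightarrow> (\<exists>C. \<forall>t\<in>I. slant_quotient I k (\<lambda>t. r t - b) t = C)"
      if a': "frenet_apparatus A g nab X I c U' V' W' k' r'" for U' V' W' k' r'
    proof -
      let ?H = "harmonic_curvature G A g X U' V' W' k' r'"
      have H: "?H t = (r' t - b) / k' t" if "t \<in> I" for t
        using b(1)[OF a' that] by (simp add: harmonic_curvature_def)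
      note un = frenet_frame_unique[OF I b(2)[OF a] b(2)[OF a'] apparatus_tangent_unique[OF a a']]
      have "vector_derivative ?H (at t within I) / (k' t * ((?H t)\<^sup>2 + 1) powr (3/2)) =
          slant_quotient I k (\<lambda>t. r t - b) t" if t: "t \<in> I" for t
      proof -
        have "vector_derivative ?H (at t within I) = vector_derivative (\<lambda>t. (r' t - b) / k' t) (at t within I)"
          by (rule vector_derivative_cong_eq) (use H t in auto)
        then have "vector_derivative ?H (at t within I) / (k' t * ((?H t)\<^sup>2 + 1) powr (3/2)) =
          slant_quotient I k' (\<lambda>t. r' t - b) t"
          using H[OF t] by (simp add: slant_quotient_def)
        also have "\<dots> = slant_quotient I k (\<lambda>t. r t - b) t"
          by (rule slant_quotient_cong) (use un t in auto)
        finally show ?thesis .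
      qed
      then show ?thesis by simp
    qed
    show ?thesis
      unfolding slant_helix_def
    proof (rule iffI, elim exE conjE)
      fix U' V' W' k' r'
      assume "frenet_apparatus A g nab X I c U' V' W' k' r'"
        "let H = harmonic_curvature G A g X U' V' W' k' r' in
         \<exists>C. \<forall>t\<in>I. vector_derivative H (at t within I) / (k' t * ((H t)\<^sup>2 + 1) powr (3/2)) = C"
      then show "\<exists>C. \<forall>t\<in>I. slant_quotient I k (\<lambda>t. r t - b) t = C"
        using quot by simp
    next
      assume "\<exists>C. \<forall>t\<in>I. slant_quotient I k (\<lambda>t. r t - b) t = C"
      then have L: "let H = harmonic_curvature G A g X U V W k r in
         \<exists>C. \<forall>t\<in>I. vector_derivative H (at t within I) / (k t * ((H t)\<^sup>2 + 1) powr (3/2)) = C"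
        unfolding quot[OF a, symmetric] .
      show "\<exists>T N B \<kappa> \<tau>. frenet_apparatus A g nab X I c T N B \<kappa> \<tau> \<and>
        (let H = harmonic_curvature G A g X T N B \<kappa> \<tau> in
         \<exists>C. \<forall>t\<in>I. vector_derivative H (at t within I) / (\<kappa> t * ((H t)\<^sup>2 + 1) powr (3/2)) = C)"
        by (intro exI conjI) (rule a, rule L)
    qed
  qed
  obtain T1 N1 B1 \<kappa>1 \<tau>1 T' N' B' \<kappa>' \<tau>' where
      app1: "frenet_apparatus A g nab X I \<gamma> T1 N1 B1 \<kappa>1 \<tau>1" and
      app': "frenet_apparatus A g nab X I \<gamma>' T' N' B' \<kappa>' \<tau>'" and
      T'B1: "\<And>t. t \<in> I \<Longrightarrow> T' t = B1 t"
    using assms(11) unfolding conjugate_mate_def by blast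
  have T'B: "T' t = B t" if "t \<in> I" for t
    using T'B1[OF that] frenet_frame_unique(2)[OF I b(2)[OF app] b(2)[OF app1] apparatus_tangent_unique[OF app app1] that]
    by simp
  have diff: "\<kappa> differentiable_on I" "(\<lambda>t. \<tau> t - b) differentiable_on I"
    using frenet_frame_differentiable[OF I b(2)[OF app]] app by (auto simp: frenet_apparatus_def)
  obtain s where s: "s = 1 \<or> s = - 1" "\<And>t. t \<in> I \<Longrightarrow> \<kappa>' t = s * (\<tau> t - b)" "\<And>t. t \<in> I \<Longrightarrow> \<tau>' t - b = \<kappa> t"
    using frenet_frame_mate[OF I b(2)[OF app] b(2)[OF app'] T'B differentiable_imp_continuous_on[OF diff(2)]]
      assms(10) b(1)[OF app] by (metis (no_types, lifting))
  have mate: "slant_quotient I \<kappa>' (\<lambda>t. \<tau>' t - b) t = - s * slant_quotient I \<kappa> (\<lambda>t. \<tau> t - b) t" if t: "t \<in> I" for t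
  proof -
    have "slant_quotient I \<kappa>' (\<lambda>t. \<tau>' t - b) t = slant_quotient I (\<lambda>t. s * (\<tau> t - b)) \<kappa> t"
      by (rule slant_quotient_cong) (use s t in auto)
    also have "\<dots> = - s * slant_quotient I \<kappa> (\<lambda>t. \<tau> t - b) t"
    proof (rule slant_quotient_mate[OF interval_at_within_nontrivial[OF I t] _ _ _ _ s(1)])
      show "\<kappa> t > 0" using b(2)[OF app] t by (simp add: frenet_frame_def)
      have "\<kappa>' t > 0" using b(2)[OF app'] t by (simp add: frenet_frame_def)
      then show "s * (\<tau> t - b) > 0" using s(2)[OF t] by simp
    qed (use diff t in \<open>auto simp: differentiable_on_def\<close>)
    finally show ?thesis .
  qed
  have "(\<exists>C. \<forall>t\<in>I. slant_quotient I \<kappa> (\<lambda>t. \<tau> t - b) t = C) \<longleftrightarrow>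
        (\<exists>C. \<forall>t\<in>I. slant_quotient I \<kappa>' (\<lambda>t. \<tau>' t - b) t = C)"
  proof
    assume "\<exists>C. \<forall>t\<in>I. slant_quotient I \<kappa> (\<lambda>t. \<tau> t - b) t = C"
    then show "\<exists>C. \<forall>t\<in>I. slant_quotient I \<kappa>' (\<lambda>t. \<tau>' t - b) t = C" using mate by auto
  next
    assume "\<exists>C. \<forall>t\<in>I. slant_quotient I \<kappa>' (\<lambda>t. \<tau>' t - b) t = C"
    then obtain C where C: "\<And>t. t \<in> I \<Longrightarrow> - s * slant_quotient I \<kappa> (\<lambda>t. \<tau> t - b) t = C" using mate by auto
    have "slant_quotient I \<kappa> (\<lambda>t. \<tau> t - b) t = - s * C" if "t \<in> I" for t
      using C[OF that] s(1) by auto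
    then show "\<exists>C. \<forall>t\<in>I. slant_quotient I \<kappa> (\<lambda>t. \<tau> t - b) t = C" by blast
  qed
  then show ?thesis
    unfolding slant[OF app] slant[OF app'] .
qed

end
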